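(* For every odd prime $p$, the adjacency matrix $A_p=A(G_p)$ satisfies $$\operatorname{nullity}(A_p)=p(p+1)(p-2),\qquad m_{A_p}(-1)=(p+1)(p-2),\qquad \operatorname{rank}(A_p)=(p+1)(2p-1),$$ where $m_{A_p}(-1)$ denotes the multiplicity of the eigenvalue $-1$ of $A_p$.
   Context: For $n\ge2$, $\mathbb{L}_n=\{a+bi+cj+dk: a,b,c,d\in\mathbb{Z}/n\mathbb{Z}\}$ is the ring of Lipschitz quaternions modulo $n$, with the usual relations $i^2=j^2=k^2=-1$, $ij=k=-ji$, $jk=i=-kj$, $ki=j=-ik$ taken modulo $n$. A nonzero element $x$ of a ring is a zero divisor if $xy=0$ or $yx=0$ for some nonzero $y$. $G_n=\Gamma(\mathbb{L}_n)$ is the simple undirected graph whose vertices are the nonzero zero divisors of $\mathbb{L}_n$, distinct $x,y$ being adjacent iff $xy=0$ or $yx=0$; $A(G_n)$ is its adjacency matrix, viewed as a real matrix. (For odd primes $p$, $\mathbb{L}_p\cong M_2(\mathbb{F}_p)$.) *)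

theory Defs
  imports
    "HOL-Number_Theory.Residues"
    "Graph_Theory.Pair_Digraph"
    "Jordan_Normal_Form.Char_Poly"
    "Jordan_Normal_Form.Matrix_Kernel"
    "Jordan_Normal_Form.DL_Rank"
begin

section \<open>Lipschitz quaternions modulo n\<close>

text \<open>
  The tuple (a, b, c, d) stands for a + bi + cj + dk, its coordinates being the canonical
  representatives 0, ..., n - 1 of the elements of Z/nZ. The formulas are meant for n at least 2.
\<close>

type_synonym quat = "int \<times> int \<times> int \<times> int"

definition lipschitz_carrier :: "nat \<Rightarrow> quat set" where
  "lipschitz_carrier n =
     (let Z = carrier (residue_ring (int n)) in Z \<times> Z \<times> Z \<times> Z)"

fun quat_add :: "nat \<Rightarrow> quat \<Rightarrow> quat \<Rightarrow> quat" where
  "quat_add n (a, b, c, d) (a', b', c', d') =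
     ((a + a') mod int n, (b + b') mod int n, (c + c') mod int n, (d + d') mod int n)"

fun quat_mult :: "nat \<Rightarrow> quat \<Rightarrow> quat \<Rightarrow> quat" where
  "quat_mult n (a, b, c, d) (a', b', c', d') =
     ((a * a' - b * b' - c * c' - d * d') mod int n,
      (a * b' + b * a' + c * d' - d * c') mod int n,
      (a * c' - b * d' + c * a' + d * b') mod int n,
      (a * d' + b * c' - c * b' + d * a') mod int n)"

definition lipschitz_ring :: "nat \<Rightarrow> quat ring" where
  "lipschitz_ring n =
     \<lparr>carrier = lipschitz_carrier n,
      monoid.mult = quat_mult n,
      one = (1, 0, 0, 0),
      zero = (0, 0, 0, 0),
      add = quat_add n\<rparr>"

lemma mem_lipschitz_carrier:
  "(a, b, c, d) \<in> lipschitz_carrier n \<longleftrightarrow>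
     a \<in> {0..<int n} \<and> b \<in> {0..<int n} \<and> c \<in> {0..<int n} \<and> d \<in> {0..<int n}"
  by (auto simp: lipschitz_carrier_def residue_ring_def Let_def)

lemma finite_lipschitz_carrier: "finite (lipschitz_carrier n)"
  by (auto simp: lipschitz_carrier_def residue_ring_def Let_def)

lemma quat_mult_units:
  assumes "n \<ge> 2"
  defines "e \<equiv> (1, 0, 0, 0)" and "i \<equiv> (0, 1, 0, 0)" and "j \<equiv> (0, 0, 1, 0)" and "k \<equiv> (0, 0, 0, 1)"
  shows "quat_add n (quat_mult n i i) e = (0, 0, 0, 0)"
    and "quat_add n (quat_mult n j j) e = (0, 0, 0, 0)"
    and "quat_add n (quat_mult n k k) e = (0, 0, 0, 0)"
    and "quat_mult n i j = k" and "quat_add n (quat_mult n j i) k = (0, 0, 0, 0)"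
    and "quat_mult n j k = i" and "quat_add n (quat_mult n k j) i = (0, 0, 0, 0)"
    and "quat_mult n k i = j" and "quat_add n (quat_mult n i k) j = (0, 0, 0, 0)"
  using assms by (auto simp: mod_simps)

lemma cong_mod_self: "[t mod n = t] (mod n)" for t n :: int
  by (simp add: cong_def)

lemma mod_eqI: "[l = l'] (mod n) \<Longrightarrow> [r = r'] (mod n) \<Longrightarrow> l' = r' \<Longrightarrow> l mod n = r mod n"
  for l r n :: int
  by (simp add: cong_def)

lemma quat_add_assoc: "quat_add n (quat_add n x y) z = quat_add n x (quat_add n y z)"
  by (cases x; cases y; cases z) (simp add: mod_simps algebra_simps)

lemma quat_add_comm: "quat_add n x y = quat_add n y x"
  by (cases x; cases y) (simp add: algebra_simps)

lemma quat_mult_assoc: "quat_mult n (quat_mult n x y) z = quat_mult n x (quat_mult n y z)"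
proof -
  obtain a b c d where x: "x = (a, b, c, d)" by (cases x) auto
  obtain a' b' c' d' where y: "y = (a', b', c', d')" by (cases y) auto
  obtain a'' b'' c'' d'' where z: "z = (a'', b'', c'', d'')" by (cases z) auto
  show ?thesis
    unfolding x y z quat_mult.simps prod.inject
    by (intro conjI; (rule mod_eqI,
          (rule cong_mod_self cong_add cong_diff cong_mult cong_refl)+,
          simp only: algebra_simps))
qed

lemma quat_distrib_left:
  "quat_mult n x (quat_add n y z) = quat_add n (quat_mult n x y) (quat_mult n x z)"
proof -
  obtain a b c d where x: "x = (a, b, c, d)" by (cases x) auto
  obtain a' b' c' d' where y: "y = (a', b', c', d')" by (cases y) auto
  obtain a'' b'' c'' d'' where z: "z = (a'', b'', c'', d'')" by (cases z) auto
  show ?thesis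
    unfolding x y z quat_mult.simps quat_add.simps prod.inject
    by (intro conjI; (rule mod_eqI,
          (rule cong_mod_self cong_add cong_diff cong_mult cong_refl)+,
          simp only: algebra_simps))
qed

lemma quat_distrib_right:
  "quat_mult n (quat_add n x y) z = quat_add n (quat_mult n x z) (quat_mult n y z)"
proof -
  obtain a b c d where x: "x = (a, b, c, d)" by (cases x) auto
  obtain a' b' c' d' where y: "y = (a', b', c', d')" by (cases y) auto
  obtain a'' b'' c'' d'' where z: "z = (a'', b'', c'', d'')" by (cases z) auto
  show ?thesis
    unfolding x y z quat_mult.simps quat_add.simps prod.inject
    by (intro conjI; (rule mod_eqI,
          (rule cong_mod_self cong_add cong_diff cong_mult cong_refl)+,
          simp only: algebra_simps))
qed

lemma ring_lipschitz_ring: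
  assumes n: "n \<ge> 2"
  shows "ring (lipschitz_ring n)"
proof (rule ringI)
  have inv: "\<exists>y\<in>lipschitz_carrier n. quat_add n y x = (0, 0, 0, 0)"
    if "x \<in> lipschitz_carrier n" for x
  proof -
    obtain a b c d where x: "x = (a, b, c, d)" by (cases x) auto
    show ?thesis
      using n unfolding x
      by (intro bexI[of _ "((- a) mod int n, (- b) mod int n, (- c) mod int n, (- d) mod int n)"])
         (auto simp: mem_lipschitz_carrier mod_simps)
  qed
  show "abelian_group (lipschitz_ring n)"
    by (rule abelian_groupI)
       (use n inv in \<open>auto simp: lipschitz_ring_def mem_lipschitz_carrier quat_add_assoc
          simp del: quat_add.simps intro: quat_add_comm\<close>,
        (use n in \<open>auto simp: mem_lipschitz_carrier\<close>))
  show "Group.monoid (lipschitz_ring n)"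
    by (rule Group.monoidI)
       (use n in \<open>auto simp: lipschitz_ring_def quat_mult_assoc mem_lipschitz_carrier\<close>)
qed (auto simp: lipschitz_ring_def quat_distrib_left quat_distrib_right)

section \<open>Zero-divisor graphs\<close>

definition zero_divisors :: "('a, 'm) ring_scheme \<Rightarrow> 'a set" where
  "zero_divisors R =
     {x \<in> carrier R - {\<zero>\<^bsub>R\<^esub>}. \<exists>y \<in> carrier R - {\<zero>\<^bsub>R\<^esub>}.
        x \<otimes>\<^bsub>R\<^esub> y = \<zero>\<^bsub>R\<^esub> \<or> y \<otimes>\<^bsub>R\<^esub> x = \<zero>\<^bsub>R\<^esub>}"

text \<open>A simple undirected graph is a loop-free symmetric digraph without parallel arcs.\<close>

definition zero_divisor_graph :: "('a, 'm) ring_scheme \<Rightarrow> 'a pair_pre_digraph" where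
  "zero_divisor_graph R =
     \<lparr>pverts = zero_divisors R,
      parcs = {(x, y). x \<in> zero_divisors R \<and> y \<in> zero_divisors R \<and> x \<noteq> y \<and>
                 (x \<otimes>\<^bsub>R\<^esub> y = \<zero>\<^bsub>R\<^esub> \<or> y \<otimes>\<^bsub>R\<^esub> x = \<zero>\<^bsub>R\<^esub>)}\<rparr>"

lemma pair_graph_zero_divisor_graph:
  assumes "finite (carrier R)"
  shows "pair_graph (zero_divisor_graph R)"
proof -
  have fin: "finite (zero_divisors R)"
    using assms by (auto simp: zero_divisors_def)
  have "parcs (zero_divisor_graph R) \<subseteq> zero_divisors R \<times> zero_divisors R"
    by (auto simp: zero_divisor_graph_def)
  then have "finite (parcs (zero_divisor_graph R))"
    using fin by (meson finite_SigmaI finite_subset)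
  moreover have "symmetric (with_proj (zero_divisor_graph R))"
    by (auto simp: symmetric_def sym_def arcs_ends_conv zero_divisor_graph_def image_iff)
  ultimately show ?thesis
    using fin by unfold_locales (auto simp: zero_divisor_graph_def)
qed

section \<open>Adjacency matrices\<close>

text \<open>
  Matrices are indexed by natural numbers, so the adjacency matrix depends on an enumeration
  \<open>vs\<close> of the vertices, that is, a list satisfying \<open>enumerates_verts\<close>.
\<close>

definition enumerates_verts :: "'a list \<Rightarrow> 'a pair_pre_digraph \<Rightarrow> bool" where
  "enumerates_verts vs G \<longleftrightarrow> distinct vs \<and> set vs = pverts G"

lemma ex_enumerates_verts:
  "\<exists>vs. enumerates_verts vs (zero_divisor_graph (lipschitz_ring n))"
proof -
  have "finite (pverts (zero_divisor_graph (lipschitz_ring n)))"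
    using finite_lipschitz_carrier[of n]
    by (auto simp: zero_divisor_graph_def zero_divisors_def lipschitz_ring_def)
  from finite_distinct_list[OF this] show ?thesis
    by (auto simp: enumerates_verts_def)
qed

definition adjacency_matrix :: "'a pair_pre_digraph \<Rightarrow> 'a list \<Rightarrow> real mat" where
  "adjacency_matrix G vs =
     mat (length vs) (length vs) (\<lambda>(r, s). if (vs ! r, vs ! s) \<in> parcs G then 1 else 0)"

definition mat_rank :: "'a :: field mat \<Rightarrow> nat" where
  "mat_rank A = vec_space.rank (dim_row A) A"

text \<open>The algebraic multiplicity; it is 0 if \<open>x\<close> is not an eigenvalue.\<close>

definition eigenvalue_mult :: "'a :: field mat \<Rightarrow> 'a \<Rightarrow> nat" where
  "eigenvalue_mult A x = order x (char_poly A)"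

end

theory Submission
  imports Defs
    "Jordan_Normal_Form.Jordan_Normal_Form_Existence"
    "Jordan_Normal_Form.Jordan_Normal_Form_Uniqueness"
begin

text \<open>
  An odd prime \<open>p\<close> divides \<open>\<alpha>^2 + \<beta>^2 + 1\<close> for suitable \<open>\<alpha>\<close> and \<open>\<beta>\<close>
  (\<open>exists_sum_of_two_squares_eq_minus_one\<close>), and such a pair identifies the Lipschitz quaternions modulo
  \<open>p\<close> with the 2 by 2 matrices over the field with \<open>p\<close> elements (\<open>entry_mult\<close>, \<open>exists_entries\<close>,
  \<open>eq_if_entries_cong\<close>). Under this identification the zero divisors are the matrices of rank one
  (\<open>zero_divisor_iff_rank_one\<close>). Such a matrix is given by its image and its kernel, two points of a
  projective line with \<open>p + 1\<close> elements, and by a nonzero scalar. Moreover \<open>x y = 0\<close> if and only if the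
  kernel of \<open>x\<close> is the image of \<open>y\<close> (\<open>mult_rank_one_eq_zero_iff\<close>).

  So the graph only depends on a "head" (the image) and a "tail" (the kernel) for every vertex: different
  vertices are adjacent if and only if the tail of one is the head of the other. Each of the \<open>m * m\<close>
  pairs of points, \<open>m = p + 1\<close>, is the pair of head and tail of exactly \<open>w = p - 1\<close> vertices. The
  vertices of a class \<open>(a, b)\<close> have the same neighbours outside the class; the class is a clique if
  \<open>a = b\<close>, and independent otherwise. Vectors that are supported on one class and have coordinate sum 0
  are therefore eigenvectors, for the eigenvalue \<open>-1\<close> if \<open>a = b\<close> and for the eigenvalue 0 otherwise.
  They span spaces of dimension \<open>m * (w - 1)\<close> and \<open>m * (m - 1) * (w - 1)\<close> (\<open>kernel_dim_zero_class_sums\<close>).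

  There are no further eigenvectors for these two eigenvalues (\<open>mat_kernel_head_tail_matrix\<close>,
  \<open>mat_kernel_shifted_head_tail_matrix\<close>): the class sums of an eigenvector form an \<open>m\<close> by \<open>m\<close> array that
  is determined by its row and column sums, and the resulting linear system for these sums has only the
  trivial solution (\<open>square_array_eq_0_if_line_sum_system\<close>).

  The nullity is now known, and the rank follows from it. For the algebraic multiplicity of \<open>-1\<close> it
  remains to see that the eigenvalue is semisimple. The kernel and the image of \<open>A + 1\<close> meet only in 0
  (\<open>shifted_head_tail_matrix_index1\<close>), so over the complex numbers all Jordan blocks for \<open>-1\<close> have
  size 1 (\<open>order_char_poly_eq_kernel_dim\<close>).
\<close>

section \<open>Nullity and rank\<close>

text \<open>
  The vectors obtained from \<open>free\<close> form a basis of the kernel: the coordinates in \<open>J\<close> read off the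
  coefficients of a linear combination, and by \<open>determined\<close> a kernel vector is the combination with
  its own coordinates in \<open>J\<close> as coefficients.
\<close>

lemma kernel_dim_eq_card_free_coordinates:
  fixes A :: "'a :: field mat"
  assumes A: "A \<in> carrier_mat nr nc" and J: "J \<subseteq> {..<nc}"
    and determined: "\<And>v. v \<in> mat_kernel A \<Longrightarrow> (\<And>j. j \<in> J \<Longrightarrow> v $ j = 0) \<Longrightarrow> v = 0\<^sub>v nc"
    and free: "\<And>j. j \<in> J \<Longrightarrow>
      \<exists>v \<in> mat_kernel A. \<forall>i \<in> J. v $ i = (if i = j then 1 else 0)"
  shows "kernel_dim A = card J"
proof -
  interpret kernel nr nc A by unfold_locales (rule A)
  from free obtain b where b: "\<And>j. j \<in> J \<Longrightarrow> b j \<in> mat_kernel A"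
    and b_coord: "\<And>i j. j \<in> J \<Longrightarrow> i \<in> J \<Longrightarrow> b j $ i = (if i = j then 1 else 0)"
    by metis
  have finJ: "finite J" using J finite_subset by blast
  have inj: "inj_on b J"
    by (rule inj_onI) (metis b_coord one_neq_zero)
  have sub: "b ` J \<subseteq> mat_kernel A" using b by auto
  have coord: "lincomb a (b ` I) $ j = (if j \<in> I then a (b j) else 0)"
    if "I \<subseteq> J" "j \<in> J" for a I j
  proof -
    have "lincomb a (b ` I) $ j = (\<Sum>i\<in>I. a (b i) * b i $ j)"
      using that J sub inj
      by (subst lincomb_index) (auto simp: sum.reindex inj_on_subset)
    also have "\<dots> = (\<Sum>i\<in>I. if i = j then a (b i) else 0)"
      using that by (intro sum.cong) (auto simp: b_coord)
    finally show ?thesis using that finJ by (simp add: finite_subset)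
  qed
  have "Ker.basis (b ` J)"
    unfolding Ker.basis_def
  proof (intro conjI)
    show "b ` J \<subseteq> mat_kernel A" by (rule sub)
    show "lin_indpt (b ` J)"
    proof
      assume "lin_dep (b ` J)"
      then obtain U a x where U: "U \<subseteq> b ` J" "lincomb a U = 0\<^sub>v nc" "x \<in> U" "a x \<noteq> 0"
        unfolding Ker.lin_dep_def by (auto simp: class_ring_simps)
      from U(1) obtain I where I: "I \<subseteq> J" "U = b ` I" by (auto simp: subset_image_iff)
      from U(3) I obtain j where j: "j \<in> I" "x = b j" by auto
      then have "a x = lincomb a U $ j" using coord[OF I(1), of j a] I by auto
      then show False using U(2,4) j I J by auto
    qed
    show "span (b ` J) = mat_kernel A"
    proof
      show "span (b ` J) \<subseteq> mat_kernel A" using sub by (rule Ker.span_is_subset2)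
      show "mat_kernel A \<subseteq> span (b ` J)"
      proof
        fix v assume v: "v \<in> mat_kernel A"
        define a where "a = (\<lambda>x. v $ the_inv_into J b x)"
        let ?l = "lincomb a (b ` J)"
        have l: "?l \<in> mat_kernel A" using sub by (intro Ker.lincomb_closed) auto
        have vc: "v \<in> carrier_vec nc" and lc: "?l \<in> carrier_vec nc"
          using v l A mat_kernelD by blast+
        have "v - ?l \<in> mat_kernel A"
          using v l vc lc A by (auto simp: mat_kernel mult_minus_distrib_mat_vec)
        moreover have "(v - ?l) $ j = 0" if "j \<in> J" for j
        proof -
          have "j < dim_vec ?l" using that J lc by auto
          then show ?thesis using coord[OF subset_refl that, of a] that
            by (simp add: a_def the_inv_into_f_f[OF inj])
        qed
        ultimately have "v - ?l = 0\<^sub>v nc" by (rule determined)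
        then have "v $ i - ?l $ i = 0" if "i < nc" for i
          using that vc lc by (metis carrier_vecD index_minus_vec(1) index_zero_vec(1))
        then have "v = ?l" using vc lc by (intro eq_vecI) auto
        moreover have "?l \<in> span (b ` J)"
          unfolding Ker.span_def using finJ by (auto simp: class_ring_simps)
        ultimately show "v \<in> span (b ` J)" by simp
      qed
    qed
  qed
  then have "dim = card (b ` J)" using finJ by (intro Ker.dim_basis) auto
  then show ?thesis by (simp add: card_image[OF inj])
qed

text \<open>
  Fix one representative \<open>r q\<close> in each class \<open>q \<in> Q\<close>. The other \<open>w - 1\<close> coordinates of the class can be
  prescribed freely, and the zero sum then determines the coordinate of the representative.
\<close>

lemma kernel_dim_zero_class_sums:
  fixes B :: "'a :: field mat" and c :: "nat \<Rightarrow> 'c"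
  assumes B: "B \<in> carrier_mat nr n" and Q: "finite Q" and w: "0 < w"
    and card_class: "\<And>q. q \<in> Q \<Longrightarrow> card {i. i < n \<and> c i = q} = w"
    and ker: "mat_kernel B = {v \<in> carrier_vec n. (\<forall>i<n. c i \<notin> Q \<longrightarrow> v $ i = 0) \<and>
      (\<forall>q\<in>Q. (\<Sum>i | i < n \<and> c i = q. v $ i) = 0)}"
  shows "kernel_dim B = card Q * (w - 1)"
proof -
  have "\<exists>i. i < n \<and> c i = q" if "q \<in> Q" for q
    using card_class[OF that] w by (metis (mono_tags, lifting) Collect_empty_eq card.empty less_numeral_extra(3))
  then obtain r where r: "\<And>q. q \<in> Q \<Longrightarrow> r q < n \<and> c (r q) = q" by metis
  define J where "J = (\<Union>q\<in>Q. {i. i < n \<and> c i = q} - {r q})"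
  have "card J = (\<Sum>q\<in>Q. card ({i. i < n \<and> c i = q} - {r q}))"
    unfolding J_def using Q by (intro card_UN_disjoint) auto
  also have "\<dots> = (\<Sum>q\<in>Q. w - 1)"
    using r card_class by (intro sum.cong) auto
  finally have cardJ: "card J = card Q * (w - 1)" by simp
  have "kernel_dim B = card J"
  proof (rule kernel_dim_eq_card_free_coordinates[OF B])
    show "J \<subseteq> {..<n}" unfolding J_def by auto
  next
    fix v assume v: "v \<in> mat_kernel B" and v0: "\<And>j. j \<in> J \<Longrightarrow> v $ j = 0"
    have "v $ i = 0" if i: "i < n" for i
    proof (cases "c i \<in> Q \<and> i = r (c i)")
      case True
      have "0 = (\<Sum>j | j < n \<and> c j = c i. v $ j)" using v True by (simp add: ker)
      also have "\<dots> = v $ i + (\<Sum>j\<in>{j. j < n \<and> c j = c i} - {i}. v $ j)"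
        using i by (intro sum.remove) auto
      also have "(\<Sum>j\<in>{j. j < n \<and> c j = c i} - {i}. v $ j) = 0"
        using True v0 by (intro sum.neutral) (auto simp: J_def)
      finally show ?thesis by simp
    next
      case False
      then show ?thesis using v v0 i by (cases "c i \<in> Q") (auto simp: ker J_def)
    qed
    then show "v = 0\<^sub>v n" using v by (auto simp: ker)
  next
    fix j assume "j \<in> J"
    then have j: "j < n" "c j \<in> Q" "j \<noteq> r (c j)" by (auto simp: J_def)
    define v :: "'a vec" where "v = vec n (\<lambda>i. if i = j then 1 else if i = r (c j) then - 1 else 0)"
    have "(\<Sum>i | i < n \<and> c i = q. v $ i) = 0" if q: "q \<in> Q" for q
    proof (cases "q = c j")
      case True
      have "(\<Sum>i | i < n \<and> c i = q. v $ i) = (\<Sum>i\<in>{j, r (c j)}. v $ i)"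
        using True j r by (intro sum.mono_neutral_right) (auto simp: v_def)
      then show ?thesis using j r by (simp add: v_def)
    next
      case False
      then show ?thesis using j r q by (intro sum.neutral) (auto simp: v_def)
    qed
    then have "v \<in> mat_kernel B"
      using j r unfolding ker by (auto simp: v_def)
    moreover have "v $ i = (if i = j then 1 else 0)" if "i \<in> J" for i
      using that j r by (auto simp: v_def J_def)
    ultimately show "\<exists>v\<in>mat_kernel B. \<forall>i\<in>J. v $ i = (if i = j then 1 else 0)" by blast
  qed
  with cardJ show ?thesis by simp
qed

lemma rank_plus_kernel_dim:
  fixes A :: "'a :: field mat"
  assumes A: "A \<in> carrier_mat nr nc"
  shows "mat_rank A + kernel_dim A = nc"
proof -
  interpret K: kernel nr nc A by unfold_locales (rule A)
  interpret W: vec_space "TYPE('a)" nr .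
  interpret T: linear_map class_ring K.NC.V W.V "\<lambda>v. A *\<^sub>v v"
    by unfold_locales (use A in \<open>auto simp: module_hom_def mult_add_distrib_mat_vec mult_mat_vec\<close>)
  have "T.imT = W.span (set (cols A))"
    using A unfolding T.im_def
    by (fold W.col_space_def) (subst W.col_space_eq[OF A], auto)
  moreover have "T.kerT = mat_kernel A"
    using A unfolding T.ker_def by (auto simp: mat_kernel)
  moreover note T.rank_nullity[OF K.NC.fin_dim]
  ultimately show ?thesis
    using A unfolding mat_rank_def kernel_dim_def by (simp add: W.rank_def K.NC.dim_is_n)
qed

section \<open>Algebraic multiplicity of a semisimple eigenvalue\<close>

lemma pow_mat_mult_vec_eq_0:
  fixes B :: "'a :: field mat"
  assumes B: "B \<in> carrier_mat n n" and v: "v \<in> carrier_vec n"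
    and index1: "\<And>v. v \<in> carrier_vec n \<Longrightarrow> B *\<^sub>v (B *\<^sub>v v) = 0\<^sub>v n \<Longrightarrow> B *\<^sub>v v = 0\<^sub>v n"
    and "(B ^\<^sub>m Suc k) *\<^sub>v v = 0\<^sub>v n"
  shows "B *\<^sub>v v = 0\<^sub>v n"
  using assms(4) v
proof (induction k arbitrary: v)
  case 0
  then show ?case using B by simp
next
  case (Suc k)
  have "(B ^\<^sub>m Suc k) *\<^sub>v (B *\<^sub>v v) = (B ^\<^sub>m Suc (Suc k)) *\<^sub>v v"
    unfolding pow_mat.simps(2)[of B "Suc k"]
    using B Suc.prems by (intro assoc_mult_mat_vec[symmetric]) (auto intro: pow_carrier_mat)
  then have "B *\<^sub>v (B *\<^sub>v v) = 0\<^sub>v n"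
    using Suc.IH[of "B *\<^sub>v v"] Suc.prems B by simp
  then show ?case using index1 Suc.prems by simp
qed

text \<open>
  In a Jordan normal form, the order of the root \<open>e\<close> is the total size of the blocks for \<open>e\<close>, which is
  also the dimension of the kernel of every high power of \<open>A - e\<close>. By \<open>index1\<close> these powers all have
  the kernel of \<open>A - e\<close> itself.
\<close>

lemma order_char_poly_eq_kernel_dim:
  fixes A :: "complex mat"
  assumes A: "A \<in> carrier_mat n n"
    and index1: "\<And>v. v \<in> carrier_vec n \<Longrightarrow>
      char_matrix A e *\<^sub>v (char_matrix A e *\<^sub>v v) = 0\<^sub>v n \<Longrightarrow> char_matrix A e *\<^sub>v v = 0\<^sub>v n"
  shows "order e (char_poly A) = kernel_dim (char_matrix A e)"
proof -
  let ?B = "char_matrix A e"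
  have B: "?B \<in> carrier_mat n n" using A by simp
  obtain n_as where jnf: "jordan_nf A n_as"
    using char_poly_factorized[OF A] jordan_nf_exists[OF A] by blast
  let ?ns = "map fst [(n, a)\<leftarrow>n_as. a = e]"
  \<comment> \<open>The successor makes the exponent positive, and it exceeds the size of every block for \<open>e\<close>.\<close>
  let ?N = "Suc (sum_list ?ns)"
  have "mat_kernel (?B ^\<^sub>m ?N) = mat_kernel ?B"
  proof
    show "mat_kernel (?B ^\<^sub>m ?N) \<subseteq> mat_kernel ?B"
    proof
      fix v assume "v \<in> mat_kernel (?B ^\<^sub>m ?N)"
      then have v: "v \<in> carrier_vec n" "(?B ^\<^sub>m ?N) *\<^sub>v v = 0\<^sub>v n"
        using mat_kernelD[OF pow_carrier_mat[OF B]] by blast+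
      show "v \<in> mat_kernel ?B"
        by (rule mat_kernelI[OF B v(1) pow_mat_mult_vec_eq_0[OF B v(1) index1 v(2)]])
    qed
    show "mat_kernel ?B \<subseteq> mat_kernel (?B ^\<^sub>m ?N)"
      unfolding pow_mat.simps using B by (intro mat_kernel_mult_subset[OF B]) auto
  qed
  then have "kernel_dim (?B ^\<^sub>m ?N) = kernel_dim ?B"
    using B pow_carrier_mat[OF B, of ?N] unfolding kernel_dim_def by auto
  moreover have "kernel_dim (?B ^\<^sub>m ?N) = (\<Sum>k\<leftarrow>?ns. min ?N k)"
    using dim_gen_eigenspace[OF jnf] by (simp only: dim_gen_eigenspace_def)
  moreover have "min ?N k = k" if "k \<in> set ?ns" for k
    using member_le_sum_list[OF that] by linarith
  then have "(\<Sum>k\<leftarrow>?ns. min ?N k) = sum_list ?ns"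
    by (metis (no_types, lifting) list.map_id list.map_cong0 map_idI)
  moreover have "order e (char_poly A) = sum_list ?ns"
    by (simp add: jordan_nf_order[OF jnf] case_prod_unfold)
  ultimately show ?thesis by simp
qed

text \<open>
  The order of a root does not change under a field extension, and over the complex numbers a Jordan
  normal form exists.
\<close>

lemma eigenvalue_mult_eq_kernel_dim_complex:
  fixes A :: "real mat" and e :: real
  assumes A: "A \<in> carrier_mat n n"
  defines "B \<equiv> char_matrix (map_mat complex_of_real A) (complex_of_real e)"
  assumes index1: "\<And>v. v \<in> carrier_vec n \<Longrightarrow> B *\<^sub>v (B *\<^sub>v v) = 0\<^sub>v n \<Longrightarrow> B *\<^sub>v v = 0\<^sub>v n"
  shows "eigenvalue_mult A e = kernel_dim B"
proof -
  interpret map_poly_inj_idom_divide_hom complex_of_real ..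
  have "eigenvalue_mult A e = order (complex_of_real e) (map_poly complex_of_real (char_poly A))"
    unfolding eigenvalue_mult_def by (simp add: order_hom)
  also have "map_poly complex_of_real (char_poly A) = char_poly (map_mat complex_of_real A)"
    by (rule of_real_hom.char_poly_hom[OF A, symmetric])
  also have "order (complex_of_real e) \<dots> = kernel_dim B"
    unfolding B_def
    by (rule order_char_poly_eq_kernel_dim[of _ n]) (use A index1 in \<open>auto simp: B_def\<close>)
  finally show ?thesis .
qed

section \<open>Matrices of head-tail adjacency\<close>

text \<open>
  Summing \<open>off\<close> and \<open>diag\<close> along a row and along a column gives two linear equations for \<open>R a\<close>, \<open>C a\<close>
  and the total sum \<open>T\<close>. Their difference forces \<open>R a = C a\<close>, then \<open>R a\<close> is a fixed multiple of \<open>T\<close>,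
  and a further summation over \<open>a\<close> forces \<open>T = 0\<close>. The inequalities \<open>det\<close> say that the three
  coefficients by which these steps divide are nonzero.
\<close>

lemma square_array_eq_0_if_line_sum_system:
  fixes F :: "'p \<Rightarrow> 'p \<Rightarrow> 'a :: field"
  assumes P: "finite P"
  defines "R \<equiv> \<lambda>a. \<Sum>b\<in>P. F a b" and "C \<equiv> \<lambda>b. \<Sum>a\<in>P. F a b"
    and "N \<equiv> of_nat (card P - 1) :: 'a"
  assumes off: "\<And>a b. a \<in> P \<Longrightarrow> b \<in> P \<Longrightarrow> a \<noteq> b \<Longrightarrow>
      F a b = \<alpha> * (R a + C b) + \<beta> * (R b + C a)"
    and diag: "\<And>a. a \<in> P \<Longrightarrow> F a a = \<gamma> * (R a + C a)"
    and det: "(\<alpha> - \<beta>) * (N + 1) \<noteq> 1" "1 - 2 * \<gamma> - (\<alpha> + \<beta>) * (N - 1) \<noteq> 0"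
      "1 - 2 * \<gamma> - 2 * (\<alpha> + \<beta>) * N \<noteq> 0"
    and a: "a \<in> P"
  shows "R a = 0" and "C a = 0"
proof -
  define T where "T = (\<Sum>a\<in>P. R a)"
  have T': "T = (\<Sum>a\<in>P. C a)" unfolding T_def R_def C_def by (rule sum.swap)
  have sum_R: "(\<Sum>b\<in>P - {a}. R b) = T - R a" and sum_C: "(\<Sum>b\<in>P - {a}. C b) = T - C a"
    if "a \<in> P" for a
    using that P by (simp add: T_def sum_diff1, simp add: T' sum_diff1)
  have row: "R a = \<gamma> * (R a + C a) + \<alpha> * (N * R a + T - C a) + \<beta> * (T - R a + N * C a)"
    if "a \<in> P" for a
  proof -
    have "R a = F a a + (\<Sum>b\<in>P - {a}. F a b)"
      unfolding R_def using that P by (simp add: sum.remove)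
    also have "(\<Sum>b\<in>P - {a}. F a b) = (\<Sum>b\<in>P - {a}. \<alpha> * (R a + C b) + \<beta> * (R b + C a))"
      using that off by (intro sum.cong) auto
    also have "\<dots> = \<alpha> * (N * R a + T - C a) + \<beta> * (T - R a + N * C a)"
      using that P
      by (simp add: sum.distrib sum_distrib_left[symmetric] sum_R sum_C N_def algebra_simps)
    finally show ?thesis using diag[OF that] by (simp only: add.assoc)
  qed
  have col: "C a = \<gamma> * (R a + C a) + \<alpha> * (T - R a + N * C a) + \<beta> * (N * R a + T - C a)"
    if "a \<in> P" for a
  proof -
    have "C a = F a a + (\<Sum>b\<in>P - {a}. F b a)"
      unfolding C_def using that P by (simp add: sum.remove)
    also have "(\<Sum>b\<in>P - {a}. F b a) = (\<Sum>b\<in>P - {a}. \<alpha> * (R b + C a) + \<beta> * (R a + C b))"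
      using that off by (intro sum.cong) auto
    also have "\<dots> = \<alpha> * (T - R a + N * C a) + \<beta> * (N * R a + T - C a)"
      using that P
      by (simp add: sum.distrib sum_distrib_left[symmetric] sum_R sum_C N_def algebra_simps)
    finally show ?thesis using diag[OF that] by (simp only: add.assoc)
  qed
  have RC: "R a = C a" if "a \<in> P" for a
  proof -
    have "R a - C a = (\<gamma> * (R a + C a) + \<alpha> * (N * R a + T - C a) + \<beta> * (T - R a + N * C a)) -
        (\<gamma> * (R a + C a) + \<alpha> * (T - R a + N * C a) + \<beta> * (N * R a + T - C a))"
      by (rule arg_cong2[OF row[OF that] col[OF that]])
    also have "\<dots> = (\<alpha> - \<beta>) * (N + 1) * (R a - C a)" by (simp add: algebra_simps)
    finally have "((\<alpha> - \<beta>) * (N + 1) - 1) * (R a - C a) = 0" by (simp add: left_diff_distrib)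
    then show ?thesis using det(1) by simp
  qed
  have R_T: "(1 - 2 * \<gamma> - (\<alpha> + \<beta>) * (N - 1)) * R a = (\<alpha> + \<beta>) * T" if "a \<in> P" for a
  proof -
    have solve: "(1 - x) * r = y" if "r = x * r + y" for r x y :: 'a
      using that by (simp add: left_diff_distrib diff_eq_eq add.commute)
    have "R a = \<gamma> * (R a + R a) + \<alpha> * (N * R a + T - R a) + \<beta> * (T - R a + N * R a)"
      using row[OF that] unfolding RC[OF that, symmetric] .
    also have "\<dots> = (2 * \<gamma> + (\<alpha> + \<beta>) * (N - 1)) * R a + (\<alpha> + \<beta>) * T"
      by (simp add: algebra_simps)
    finally show ?thesis using solve by (simp only: diff_diff_eq)
  qed
  have cardP: "of_nat (card P) = N + 1"
    using a P by (metis N_def Suc_diff_1 add.commute card_gt_0_iff empty_iff of_nat_Suc)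
  have "(1 - 2 * \<gamma> - (\<alpha> + \<beta>) * (N - 1)) * T = (\<Sum>a\<in>P. (\<alpha> + \<beta>) * T)"
    by (subst (1) T_def, unfold sum_distrib_left, intro sum.cong) (auto simp: R_T)
  also have "\<dots> = (N + 1) * ((\<alpha> + \<beta>) * T)" by (simp add: cardP)
  finally have T_eq: "(1 - 2 * \<gamma> - (\<alpha> + \<beta>) * (N - 1)) * T = (N + 1) * ((\<alpha> + \<beta>) * T)" .
  have "(1 - 2 * \<gamma> - 2 * (\<alpha> + \<beta>) * N) * T =
      (1 - 2 * \<gamma> - (\<alpha> + \<beta>) * (N - 1)) * T - (N + 1) * ((\<alpha> + \<beta>) * T)"
    by (simp add: algebra_simps)
  then have "(1 - 2 * \<gamma> - 2 * (\<alpha> + \<beta>) * N) * T = 0" using T_eq by simp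
  then have "T = 0" using det(3) by simp
  then show "R a = 0" using R_T[OF a] det(2) by simp
  with RC[OF a] show "C a = 0" by simp
qed

text \<open>
  For the zero-divisor graph of a 2 by 2 matrix ring over a field, the head of a vertex is the image
  and the tail is the kernel of a matrix of rank one.
\<close>

definition head_tail_matrix :: "nat \<Rightarrow> (nat \<Rightarrow> 'p) \<Rightarrow> (nat \<Rightarrow> 'p) \<Rightarrow> 'a :: field mat" where
  "head_tail_matrix n h t =
     mat n n (\<lambda>(i, j). if i \<noteq> j \<and> (t i = h j \<or> t j = h i) then 1 else 0)"

lemma head_tail_matrix_carrier [simp]: "head_tail_matrix n h t \<in> carrier_mat n n"
  by (simp add: head_tail_matrix_def)

lemma of_nat_pos_neq_0: "0 < k \<Longrightarrow> of_nat k \<noteq> (0 :: 'a :: field_char_0)"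
  by simp

lemma char_matrix_mult_vec_index:
  assumes "A \<in> carrier_mat n n" "v \<in> carrier_vec n" "i < n"
  shows "(char_matrix A e *\<^sub>v v) $ i = (A *\<^sub>v v) $ i - e * v $ i"
  using assms unfolding char_matrix_def
  by (simp add: add_scalar_prod_distrib[of _ n] row_add smult_scalar_prod_distrib[of _ n])

locale equal_head_tail_classes =
  fixes n :: nat and P :: "'p set" and h t :: "nat \<Rightarrow> 'p" and m w :: nat
  assumes finite_P: "finite P" and card_P: "card P = m" and m: "2 \<le> m" and w: "2 \<le> w"
    and h: "i < n \<Longrightarrow> h i \<in> P" and t: "i < n \<Longrightarrow> t i \<in> P"
    and card_class: "a \<in> P \<Longrightarrow> b \<in> P \<Longrightarrow> card {i. i < n \<and> h i = a \<and> t i = b} = w"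
begin

definition class_sum :: "'a :: field_char_0 vec \<Rightarrow> 'p \<Rightarrow> 'p \<Rightarrow> 'a" where
  "class_sum v a b = (\<Sum>i | i < n \<and> h i = a \<and> t i = b. v $ i)"

definition head_sum :: "'a :: field_char_0 vec \<Rightarrow> 'p \<Rightarrow> 'a" where
  "head_sum v a = (\<Sum>b\<in>P. class_sum v a b)"

definition tail_sum :: "'a :: field_char_0 vec \<Rightarrow> 'p \<Rightarrow> 'a" where
  "tail_sum v b = (\<Sum>a\<in>P. class_sum v a b)"

lemma head_sum_eq: "head_sum v a = (\<Sum>i | i < n \<and> h i = a. v $ i)"
proof -
  have "(\<Sum>i | i < n \<and> h i = a. v $ i) =
      (\<Sum>b\<in>P. \<Sum>i | i \<in> {i. i < n \<and> h i = a} \<and> t i = b. v $ i)"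
    using finite_P t by (intro sum.group[symmetric]) auto
  then show ?thesis by (simp add: head_sum_def class_sum_def conj_assoc)
qed

lemma tail_sum_eq: "tail_sum v b = (\<Sum>i | i < n \<and> t i = b. v $ i)"
proof -
  have "(\<Sum>i | i < n \<and> t i = b. v $ i) =
      (\<Sum>a\<in>P. \<Sum>i | i \<in> {i. i < n \<and> t i = b} \<and> h i = a. v $ i)"
    using finite_P h by (intro sum.group[symmetric]) auto
  also have "\<dots> = tail_sum v b"
    unfolding tail_sum_def class_sum_def by (intro sum.cong refl) auto
  finally show ?thesis by simp
qed

text \<open>
  This is inclusion-exclusion: the vertices with head \<open>t i\<close> and those with tail \<open>h i\<close> meet in the class
  \<open>(t i, h i)\<close>, and the vertex \<open>i\<close> itself is among them if and only if its head is its tail.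
\<close>

lemma head_tail_matrix_mult_vec_index:
  fixes v :: "'a :: field_char_0 vec"
  assumes v: "v \<in> carrier_vec n" and i: "i < n"
  shows "(head_tail_matrix n h t *\<^sub>v v) $ i =
    head_sum v (t i) + tail_sum v (h i) - class_sum v (t i) (h i) - (if h i = t i then v $ i else 0)"
proof -
  let ?H = "{j. j < n \<and> h j = t i}" and ?T = "{j. j < n \<and> t j = h i}"
  have "(head_tail_matrix n h t *\<^sub>v v) $ i =
      (\<Sum>j<n. if i \<noteq> j \<and> (t i = h j \<or> t j = h i) then v $ j else 0)"
    using v i by (auto simp: head_tail_matrix_def scalar_prod_def lessThan_atLeast0 intro!: sum.cong)
  also have "\<dots> = sum (($) v) (?H \<union> ?T - {i})"
    by (subst sum.inter_filter[symmetric]) (auto intro!: sum.cong)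
  also have "\<dots> = sum (($) v) (?H \<union> ?T) - (if h i = t i then v $ i else 0)"
    using i by (simp add: sum_diff1)
  also have "sum (($) v) (?H \<union> ?T) = sum (($) v) ?H + sum (($) v) ?T - sum (($) v) (?H \<inter> ?T)"
    by (intro sum_Un) auto
  also have "?H \<inter> ?T = {j. j < n \<and> h j = t i \<and> t j = h i}" by auto
  finally show ?thesis by (simp add: head_sum_eq tail_sum_eq class_sum_def)
qed

lemma class_nonempty:
  assumes "a \<in> P" "b \<in> P"
  shows "\<exists>i<n. h i = a \<and> t i = b"
  using card_class[OF assms] w
  by (metis (mono_tags, lifting) Collect_empty_eq card.empty not_numeral_le_zero)

lemma sum_const_class:
  assumes "a \<in> P" "b \<in> P" and "\<And>i. i < n \<Longrightarrow> h i = a \<Longrightarrow> t i = b \<Longrightarrow> v $ i = k"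
  shows "class_sum v a b = of_nat w * k"
  using assms by (simp add: class_sum_def card_class)

text \<open>
  Both eigenspaces under consideration turn out to be of this form.
\<close>

definition zero_class_sums :: "('p \<times> 'p) set \<Rightarrow> 'a :: field_char_0 vec set" where
  "zero_class_sums Q = {v \<in> carrier_vec n. (\<forall>i<n. (h i, t i) \<notin> Q \<longrightarrow> v $ i = 0) \<and>
     (\<forall>(a, b)\<in>Q. class_sum v a b = 0)}"

lemma kernel_dim_eq_if_kernel_eq_zero_class_sums:
  assumes "B \<in> carrier_mat n n" and Q: "Q \<subseteq> P \<times> P"
    and ker: "mat_kernel B = zero_class_sums Q"
  shows "kernel_dim B = card Q * (w - 1)"
proof (rule kernel_dim_zero_class_sums[where c = "\<lambda>i. (h i, t i)"])
  show "finite Q" using Q finite_P by (meson finite_SigmaI finite_subset)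
  show "card {i. i < n \<and> (h i, t i) = q} = w" if "q \<in> Q" for q
    using that Q card_class[of "fst q" "snd q"] by (cases q) auto
qed (use assms w in \<open>auto simp: zero_class_sums_def class_sum_def split: prod.splits\<close>)

lemma class_sum_eq_0_if_mem_zero_class_sums:
  assumes "v \<in> zero_class_sums Q"
  shows "class_sum v a b = 0"
proof (cases "(a, b) \<in> Q")
  case False
  then show ?thesis using assms unfolding class_sum_def zero_class_sums_def
    by (intro sum.neutral) auto
qed (use assms in \<open>auto simp: zero_class_sums_def\<close>)

text \<open>
  Written in \<open>M\<close> and \<open>W\<close>, the coefficients that must not vanish become, up to nonzero factors, sums of
  natural numbers with a positive constant term.
\<close>

lemma obtain_excess: obtains M W where "m = M + 2" "w = W + 2"
  using m w by (metis le_add_diff_inverse2)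

text \<open>
  At a vertex of class \<open>(b, a)\<close> with \<open>a \<noteq> b\<close> the kernel equation says that the class sum at \<open>(a, b)\<close> is
  the head sum of \<open>a\<close> plus the tail sum of \<open>b\<close>. On a class \<open>(a, a)\<close> it makes the vector constant. So
  the array of class sums solves a system as in \<open>square_array_eq_0_if_line_sum_system\<close>; all class
  sums then vanish, and with them the constants on the diagonal classes.
\<close>

lemma mat_kernel_head_tail_matrix:
  "mat_kernel (head_tail_matrix n h t :: 'a :: field_char_0 mat) =
     zero_class_sums {(a, b) \<in> P \<times> P. a \<noteq> b}"
    (is "mat_kernel ?A = zero_class_sums ?Q")
proof
  show "mat_kernel ?A \<subseteq> zero_class_sums ?Q"
  proof
    fix v :: "'a vec" assume "v \<in> mat_kernel ?A"
    then have v: "v \<in> carrier_vec n" and "?A *\<^sub>v v = 0\<^sub>v n"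
      using mat_kernelD[OF head_tail_matrix_carrier] by blast+
    then have eq: "head_sum v (t i) + tail_sum v (h i) - class_sum v (t i) (h i)
        - (if h i = t i then v $ i else 0) = 0" if "i < n" for i
      using head_tail_matrix_mult_vec_index[OF v that] that by simp
    have off: "class_sum v a b = head_sum v a + tail_sum v b" if "a \<in> P" "b \<in> P" "a \<noteq> b" for a b
      using class_nonempty[of b a] eq that by fastforce
    have "class_sum v a a = of_nat w * (head_sum v a + tail_sum v a - class_sum v a a)"
      if "a \<in> P" for a
      using that eq by (intro sum_const_class) (fastforce simp: algebra_simps)+
    then have "(of_nat w + 1) * class_sum v a a = of_nat w * (head_sum v a + tail_sum v a)"
      if "a \<in> P" for a using that by (simp add: algebra_simps)
    moreover have w1: "(of_nat w + 1 :: 'a) \<noteq> 0"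
      using of_nat_pos_neq_0[of "w + 1", where ?'a = 'a] by (simp add: add.commute)
    ultimately have diag: "class_sum v a a =
        of_nat w / (of_nat w + 1) * (head_sum v a + tail_sum v a)" if "a \<in> P" for a
      using that by (simp add: field_simps)
    obtain M W where MW: "m = M + 2" "w = W + 2" by (rule obtain_excess)
    have det: "(1 - 0) * (of_nat (card P - 1) + 1) \<noteq> (1 :: 'a)"
      "1 - 2 * (of_nat w / (of_nat w + 1)) - (1 + 0) * (of_nat (card P - 1) - 1) \<noteq> (0 :: 'a)"
      "1 - 2 * (of_nat w / (of_nat w + 1)) - 2 * (1 + 0) * of_nat (card P - 1) \<noteq> (0 :: 'a)"
      using w1 of_nat_pos_neq_0[of "M + 1", where ?'a = 'a]
        of_nat_pos_neq_0[of "W + 1 + (w + 1) * M", where ?'a = 'a]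
        of_nat_pos_neq_0[of "W + 1 + 2 * (w + 1) * (M + 1)", where ?'a = 'a]
      unfolding card_P MW
      by (simp_all add: field_simps)
        (simp_all add: eq_neg_iff_add_eq_0 neg_eq_iff_add_eq_0 algebra_simps)
    have sums: "head_sum v a = 0 \<and> tail_sum v a = 0" if "a \<in> P" for a
      using square_array_eq_0_if_line_sum_system[where P = P and F = "class_sum v" and \<alpha> = 1 and \<beta> = 0,
          folded head_sum_def tail_sum_def, OF finite_P _ diag det that] off by auto
    have zero: "class_sum v a b = 0" if "a \<in> P" "b \<in> P" for a b
      using that off diag sums by (cases "a = b") auto
    then show "v \<in> zero_class_sums ?Q"
      using v eq h t sums by (fastforce simp: zero_class_sums_def)
  qed
  show "zero_class_sums ?Q \<subseteq> mat_kernel ?A"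
  proof
    fix v :: "'a vec" assume v: "v \<in> zero_class_sums ?Q"
    then have vc: "v \<in> carrier_vec n" by (simp add: zero_class_sums_def)
    have "?A *\<^sub>v v = 0\<^sub>v n"
    proof (rule eq_vecI)
      fix i assume "i < dim_vec (0\<^sub>v n)"
      then have i: "i < n" by simp
      have "h i = t i \<Longrightarrow> v $ i = 0" using v i by (auto simp: zero_class_sums_def)
      then show "(?A *\<^sub>v v) $ i = 0\<^sub>v n $ i"
        using i by (simp add: head_tail_matrix_mult_vec_index[OF vc] head_sum_def tail_sum_def
            class_sum_eq_0_if_mem_zero_class_sums[OF v])
    qed (simp add: head_tail_matrix_def)
    then show "v \<in> mat_kernel ?A" using vc by (auto intro: mat_kernelI[OF head_tail_matrix_carrier])
  qed
qed

lemma shifted_head_tail_matrix_mult_vec_index: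
  fixes v :: "'a :: field_char_0 vec"
  assumes v: "v \<in> carrier_vec n" and i: "i < n"
  shows "(char_matrix (head_tail_matrix n h t) (- 1) *\<^sub>v v) $ i =
    head_sum v (t i) + tail_sum v (h i) - class_sum v (t i) (h i) + (if h i = t i then 0 else v $ i)"
  using assms by (simp add: char_matrix_mult_vec_index[of _ n] head_tail_matrix_mult_vec_index)

text \<open>
  Compared with the kernel of the matrix itself, the roles of the classes are exchanged: now a kernel
  vector is constant on each class \<open>(a, b)\<close> with \<open>a \<noteq> b\<close>, and it is on the diagonal classes that the
  equation involves nothing but class sums.
\<close>

lemma mat_kernel_shifted_head_tail_matrix:
  "mat_kernel (char_matrix (head_tail_matrix n h t :: 'a :: field_char_0 mat) (- 1)) =
     zero_class_sums {(a, b) \<in> P \<times> P. a = b}"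
    (is "mat_kernel ?B = zero_class_sums ?Q")
proof
  have B: "?B \<in> carrier_mat n n" by simp
  show "mat_kernel ?B \<subseteq> zero_class_sums ?Q"
  proof
    fix v :: "'a vec" assume "v \<in> mat_kernel ?B"
    then have v: "v \<in> carrier_vec n" and "?B *\<^sub>v v = 0\<^sub>v n"
      using mat_kernelD[OF B] by blast+
    then have eq: "head_sum v (t i) + tail_sum v (h i) - class_sum v (t i) (h i)
        + (if h i = t i then 0 else v $ i) = 0" if "i < n" for i
      using shifted_head_tail_matrix_mult_vec_index[OF v that] that by simp
    have diag: "class_sum v a a = 1 * (head_sum v a + tail_sum v a)" if "a \<in> P" for a
      using class_nonempty[of a a] eq that by fastforce
    have two: "class_sum v a b = of_nat w * (class_sum v b a - head_sum v b - tail_sum v a)"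
      if "a \<in> P" "b \<in> P" "a \<noteq> b" for a b
      using that eq by (intro sum_const_class) (fastforce simp: algebra_simps)+
    let ?w = "of_nat w :: 'a"
    \<comment> \<open>The equations for the classes \<open>(a, b)\<close> and \<open>(b, a)\<close> determine both class sums from the
      head and tail sums, because \<open>w^2 \<noteq> 1\<close>.\<close>
    have solve: "(c^2 - 1) * x = c^2 * k + c * l" if "x = c * (y - l)" "y = c * (x - k)" for c k l x y :: 'a
    proof -
      have cx: "c * x = y + c * k" using that(2) by (simp add: right_diff_distrib)
      have cy: "c * y = x + c * l" using that(1) by (simp add: right_diff_distrib)
      have "(c^2 - 1) * x = c * (c * x) - x" by (simp add: power2_eq_square left_diff_distrib)
      also have "\<dots> = c^2 * k + c * l"
        unfolding cx distrib_left cy by (simp add: power2_eq_square)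
      finally show ?thesis .
    qed
    have prod: "(?w^2 - 1) * class_sum v a b =
        ?w^2 * (head_sum v a + tail_sum v b) + ?w * (head_sum v b + tail_sum v a)"
      if "a \<in> P" "b \<in> P" "a \<noteq> b" for a b
      using two[OF that] two[OF that(2,1) not_sym[OF that(3)]]
      by (intro solve) (simp_all only: diff_diff_eq)
    obtain M W where MW: "m = M + 2" "w = W + 2" by (rule obtain_excess)
    have "?w - 1 = of_nat (W + 1)" "?w + 1 = of_nat (W + 3)" by (simp_all add: MW)
    then have w1: "?w - 1 \<noteq> 0" "?w + 1 \<noteq> 0"
      by (metis of_nat_pos_neq_0 zero_less_Suc Suc_eq_plus1 add_Suc_right numeral_3_eq_3)+
    have D: "?w^2 - 1 = (?w - 1) * (?w + 1)" by (simp add: power2_eq_square algebra_simps)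
    have off: "class_sum v a b = ?w^2 / (?w^2 - 1) * (head_sum v a + tail_sum v b) +
        ?w / (?w^2 - 1) * (head_sum v b + tail_sum v a)" if "a \<in> P" "b \<in> P" "a \<noteq> b" for a b
    proof -
      have "class_sum v a b = (?w^2 - 1) * class_sum v a b / (?w^2 - 1)" using w1 D by simp
      then show ?thesis unfolding prod[OF that] by (simp add: add_divide_distrib)
    qed
    have plus: "?w^2 / (?w^2 - 1) + ?w / (?w^2 - 1) = ?w / (?w - 1)"
      using w1 unfolding D by (simp add: divide_simps, simp add: power2_eq_square algebra_simps)
    have minus: "?w^2 / (?w^2 - 1) - ?w / (?w^2 - 1) = ?w / (?w + 1)"
      using w1 unfolding D by (simp add: divide_simps, simp add: power2_eq_square algebra_simps)
    have det: "(?w^2 / (?w^2 - 1) - ?w / (?w^2 - 1)) * (of_nat (card P - 1) + 1) \<noteq> 1"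
      "1 - 2 * 1 - (?w^2 / (?w^2 - 1) + ?w / (?w^2 - 1)) * (of_nat (card P - 1) - 1) \<noteq> 0"
      "1 - 2 * 1 - 2 * (?w^2 / (?w^2 - 1) + ?w / (?w^2 - 1)) * of_nat (card P - 1) \<noteq> 0"
      using w1 of_nat_pos_neq_0[of "w * M + W + 1", where ?'a = 'a]
        of_nat_pos_neq_0[of "W + 1 + w * M", where ?'a = 'a]
        of_nat_pos_neq_0[of "W + 1 + 2 * w * (M + 1)", where ?'a = 'a]
      unfolding plus minus unfolding card_P MW
      by (simp_all add: field_simps)
        (simp_all add: eq_neg_iff_add_eq_0 neg_eq_iff_add_eq_0 algebra_simps)
    have sums: "head_sum v a = 0 \<and> tail_sum v a = 0" if "a \<in> P" for a
      using square_array_eq_0_if_line_sum_system[where P = P and F = "class_sum v",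
          folded head_sum_def tail_sum_def, OF finite_P off diag det that] by auto
    have zero: "class_sum v a b = 0" if "a \<in> P" "b \<in> P" for a b
      using that off diag sums by (cases "a = b") auto
    have "v $ i = 0" if "i < n" "h i \<noteq> t i" for i
      using that eq[of i] sums zero h t by simp
    then show "v \<in> zero_class_sums ?Q"
      using v zero h t by (auto simp: zero_class_sums_def)
  qed
  show "zero_class_sums ?Q \<subseteq> mat_kernel ?B"
  proof
    fix v :: "'a vec" assume v: "v \<in> zero_class_sums ?Q"
    then have vc: "v \<in> carrier_vec n" by (simp add: zero_class_sums_def)
    have "?B *\<^sub>v v = 0\<^sub>v n"
    proof (rule eq_vecI)
      fix i assume "i < dim_vec (0\<^sub>v n)"
      then have i: "i < n" by simp
      have "h i \<noteq> t i \<Longrightarrow> v $ i = 0" using v i by (auto simp: zero_class_sums_def)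
      then show "(?B *\<^sub>v v) $ i = 0\<^sub>v n $ i"
        using i by (simp add: shifted_head_tail_matrix_mult_vec_index[OF vc] head_sum_def tail_sum_def
            class_sum_eq_0_if_mem_zero_class_sums[OF v])
    qed (use carrier_matD(1)[OF B] in auto)
    then show "v \<in> mat_kernel ?B" using vc by (auto intro: mat_kernelI[OF B])
  qed
qed

text \<open>
  On a class \<open>(a, a)\<close> all vectors in the image of the shifted matrix are constant, whereas a kernel
  vector sums to zero there and vanishes on the other classes. Hence kernel and image meet only in 0.
\<close>

lemma shifted_head_tail_matrix_index1:
  fixes v :: "'a :: field_char_0 vec"
  defines "B \<equiv> char_matrix (head_tail_matrix n h t) (- 1) :: 'a mat"
  assumes v: "v \<in> carrier_vec n" and "B *\<^sub>v (B *\<^sub>v v) = 0\<^sub>v n"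
  shows "B *\<^sub>v v = 0\<^sub>v n"
proof -
  have B: "B \<in> carrier_mat n n" by (simp add: B_def)
  let ?u = "B *\<^sub>v v"
  have "?u \<in> mat_kernel B" using assms(2,3) B by (intro mat_kernelI[OF B]) auto
  then have u: "?u \<in> zero_class_sums {(a, b) \<in> P \<times> P. a = b}"
    unfolding B_def mat_kernel_shifted_head_tail_matrix .
  have "?u $ i = 0" if i: "i < n" for i
  proof (cases "h i = t i")
    case True
    let ?k = "head_sum v (t i) + tail_sum v (t i) - class_sum v (t i) (t i)"
    have "?u $ j = ?k" if "j < n" "h j = t i" "t j = t i" for j
      unfolding B_def using shifted_head_tail_matrix_mult_vec_index[OF v that(1)] that by simp
    then have "class_sum ?u (t i) (t i) = of_nat w * ?k" and "?u $ i = ?k"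
      using i t True by (auto intro: sum_const_class)
    then show ?thesis
      using class_sum_eq_0_if_mem_zero_class_sums[OF u] w by auto
  next
    case False
    then show ?thesis using u i by (auto simp: zero_class_sums_def)
  qed
  then show ?thesis using B by (intro eq_vecI) auto
qed

lemma n_eq: "n = m * m * w"
proof -
  have "n = card (\<Union>(a, b)\<in>P \<times> P. {i. i < n \<and> h i = a \<and> t i = b})"
    using h t by (subst (1) card_lessThan[symmetric]) (rule arg_cong[of _ _ card], auto)
  also have "\<dots> = (\<Sum>(a, b)\<in>P \<times> P. w)"
    using finite_P card_class
    by (subst card_UN_disjoint) (auto intro!: sum.cong simp del: sum_constant)
  also have "\<dots> = m * m * w" using card_P by (simp add: card_cartesian_product)
  finally show ?thesis .
qed

theorem nullity_multiplicity_rank_head_tail_matrix: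
  defines "A \<equiv> head_tail_matrix n h t :: real mat"
  shows "kernel_dim A = m * (m - 1) * (w - 1)"
    and "eigenvalue_mult A (- 1) = m * (w - 1)"
    and "mat_rank A = m * (m + w - 1)"
proof -
  have A: "A \<in> carrier_mat n n" by (simp add: A_def)
  have diag: "{(a, b) \<in> P \<times> P. a = b} = (\<lambda>a. (a, a)) ` P" by auto
  then have card_diag: "card {(a, b) \<in> P \<times> P. a = b} = m"
    by (simp add: card_image inj_on_def card_P)
  have off_diag: "{(a, b) \<in> P \<times> P. a \<noteq> b} = P \<times> P - {(a, b) \<in> P \<times> P. a = b}" by auto
  have "card {(a, b) \<in> P \<times> P. a \<noteq> b} = m * m - m"
    unfolding off_diag using finite_P card_diag card_P
    by (subst card_Diff_subset) (auto simp: card_cartesian_product diag[simplified])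
  then show dim: "kernel_dim A = m * (m - 1) * (w - 1)"
    unfolding A_def
    by (subst kernel_dim_eq_if_kernel_eq_zero_class_sums[OF _ _ mat_kernel_head_tail_matrix])
      (auto simp: diff_mult_distrib2)
  have complex: "map_mat complex_of_real A = head_tail_matrix n h t"
    by (auto simp: A_def head_tail_matrix_def)
  have "eigenvalue_mult A (- 1) =
      kernel_dim (char_matrix (head_tail_matrix n h t) (- 1) :: complex mat)"
    using eigenvalue_mult_eq_kernel_dim_complex[OF A, of "- 1"]
      shifted_head_tail_matrix_index1[where ?'a = complex]
    unfolding complex of_real_minus of_real_1 by blast
  also have "\<dots> = card {(a, b) \<in> P \<times> P. a = b} * (w - 1)"
    by (rule kernel_dim_eq_if_kernel_eq_zero_class_sums[OF _ _ mat_kernel_shifted_head_tail_matrix])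
      auto
  also have "\<dots> = m * (w - 1)" by (simp only: card_diag)
  finally show "eigenvalue_mult A (- 1) = m * (w - 1)" .
  obtain M W where "m = M + 2" "w = W + 2" by (rule obtain_excess)
  then show "mat_rank A = m * (m + w - 1)"
    using rank_plus_kernel_dim[OF A] dim n_eq by (simp add: algebra_simps)
qed

end

section \<open>Minus one as a sum of two squares\<close>

text \<open>
  The values of \<open>x^2\<close> and of \<open>- 1 - y^2\<close> for \<open>0 \<le> x, y \<le> h\<close>, where \<open>p = 2 h + 1\<close>, are \<open>h + 1\<close> residues each.
  Two sets of that size must share one of the \<open>p\<close> residues.
\<close>

lemma exists_sum_of_two_squares_eq_minus_one:
  fixes p :: nat
  assumes p: "prime p" "odd p"
  shows "\<exists>x y :: int. int p dvd x\<^sup>2 + y\<^sup>2 + 1"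
proof -
  obtain h where h: "p = 2 * h + 1" using p(2) by (rule oddE)
  let ?S = "(\<lambda>x. x\<^sup>2 mod int p) ` {0..int h}" and ?T = "(\<lambda>y. (- 1 - y\<^sup>2) mod int p) ` {0..int h}"
  have inj: "x = y" if "x \<in> {0..int h}" "y \<in> {0..int h}" "int p dvd x\<^sup>2 - y\<^sup>2" for x y
  proof -
    have "int p dvd (x - y) * (x + y)" using that(3) by (simp add: power2_eq_square algebra_simps)
    then have "int p dvd x - y \<or> int p dvd x + y"
      using p(1) by (simp add: prime_dvd_mult_iff)
    then show ?thesis
    proof
      assume "int p dvd x - y"
      moreover have "\<bar>x - y\<bar> < int p" using that(1,2) h by auto
      ultimately show ?thesis using dvd_imp_le_int[of "x - y" "int p"] by force
    next
      assume "int p dvd x + y"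
      moreover have "x + y < int p" using that(1,2) h by auto
      ultimately have "x + y = 0" using that(1,2) zdvd_not_zless[of "x + y" "int p"] by force
      then show ?thesis using that(1,2) by auto
    qed
  qed
  have "inj_on (\<lambda>x. x\<^sup>2 mod int p) {0..int h}"
    by (rule inj_onI) (use inj in \<open>simp add: mod_eq_dvd_iff\<close>)
  then have cardS: "card ?S = h + 1" by (simp add: card_image)
  have "x = y" if "x \<in> {0..int h}" "y \<in> {0..int h}" "(- 1 - x\<^sup>2) mod int p = (- 1 - y\<^sup>2) mod int p" for x y
    using inj[OF that(2,1)] that(3) by (simp add: mod_eq_dvd_iff)
  then have "inj_on (\<lambda>y. (- 1 - y\<^sup>2) mod int p) {0..int h}" by (rule inj_onI)
  then have cardT: "card ?T = h + 1" by (simp add: card_image)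
  have "?S \<union> ?T \<subseteq> {0..<int p}" using p(1) prime_gt_0_nat by auto
  then have "card (?S \<union> ?T) \<le> p" using card_mono[of "{0..<int p}" "?S \<union> ?T"] by simp
  then have "?S \<inter> ?T \<noteq> {}"
    using card_Un_disjoint[of ?S ?T] unfolding cardS cardT using h by force
  then obtain x y where "x\<^sup>2 mod int p = (- 1 - y\<^sup>2) mod int p" by auto
  then have "int p dvd x\<^sup>2 - (- 1 - y\<^sup>2)" by (simp add: mod_eq_dvd_iff)
  then show ?thesis by (auto simp: algebra_simps)
qed

section \<open>Splitting the quaternions into 2 by 2 matrices\<close>

text \<open>
  These are the entries of \<open>a I + b K + c L + d K L\<close> for the 2 by 2 matrices \<open>K = (0, -1; 1, 0)\<close> and
  \<open>L = (\<alpha>, \<beta>; \<beta>, -\<alpha>)\<close>. They satisfy \<open>K^2 = -I\<close> and \<open>K L = - L K\<close>, and \<open>L^2 = (\<alpha>^2 + \<beta>^2) I\<close> is \<open>-I\<close> modulo \<open>p\<close>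
  as soon as \<open>p\<close> divides \<open>\<alpha>^2 + \<beta>^2 + 1\<close>. The indices \<open>False\<close> and \<open>True\<close> stand for the first and the second
  row or column.
\<close>

fun split_entry :: "int \<Rightarrow> int \<Rightarrow> quat \<Rightarrow> bool \<Rightarrow> bool \<Rightarrow> int" where
  "split_entry \<alpha> \<beta> (a, b, c, d) False False = a + \<alpha> * c - \<beta> * d"
| "split_entry \<alpha> \<beta> (a, b, c, d) False True = - b + \<beta> * c + \<alpha> * d"
| "split_entry \<alpha> \<beta> (a, b, c, d) True False = b + \<beta> * c + \<alpha> * d"
| "split_entry \<alpha> \<beta> (a, b, c, d) True True = a - \<alpha> * c + \<beta> * d"

text \<open>
  The \<open>p + 1\<close> points of the projective line over the field with \<open>p\<close> elements are numbered by \<open>0, ..., p\<close>: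
  the number \<open>u < p\<close> stands for the point through \<open>(1, u)\<close> and \<open>p\<close> for the point through \<open>(0, 1)\<close>.
\<close>

definition point :: "nat \<Rightarrow> nat \<Rightarrow> bool \<Rightarrow> int" where
  "point p u i = (if u = p then if i then 1 else 0 else if i then int u else 1)"

text \<open>
  The product \<open>dot (perp a) b\<close> is the determinant of the matrix with columns \<open>a\<close> and \<open>b\<close>, so it detects
  proportional vectors.
\<close>

definition perp :: "(bool \<Rightarrow> int) \<Rightarrow> bool \<Rightarrow> int" where
  "perp a i = (if i then a False else - a True)"

definition dot :: "(bool \<Rightarrow> int) \<Rightarrow> (bool \<Rightarrow> int) \<Rightarrow> int" where
  "dot a b = a False * b False + a True * b True"

locale split_quaternions =
  fixes p :: nat and \<alpha> \<beta> :: int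
  assumes p: "prime p" "odd p" and split: "int p dvd \<alpha>\<^sup>2 + \<beta>\<^sup>2 + 1"
begin

abbreviation entry :: "quat \<Rightarrow> bool \<Rightarrow> bool \<Rightarrow> int" where "entry \<equiv> split_entry \<alpha> \<beta>"

lemma prime_int_p: "prime (int p)"
  using p(1) by simp

lemma cong_if_eq_minus_split_multiple:
  assumes "[l = l'] (mod int p)" "l' = r - (\<alpha>\<^sup>2 + \<beta>\<^sup>2 + 1) * k"
  shows "[l = r] (mod int p)"
proof -
  have "[l' = r] (mod int p)"
    unfolding assms(2) cong_iff_dvd_diff using split by simp
  with assms(1) show ?thesis by (rule cong_trans)
qed

text \<open>
  As polynomials in the coordinates, before any reduction modulo \<open>p\<close>, the two sides differ by a
  multiple of \<open>\<alpha>^2 + \<beta>^2 + 1\<close>. The cofactor is the witness \<open>k\<close> given in each of the four cases.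
\<close>

lemma entry_mult:
  "[entry (quat_mult p x y) i j = dot (entry x i) (\<lambda>l. entry y l j)] (mod int p)"
proof -
  obtain a b c d where x: "x = (a, b, c, d)" by (cases x) auto
  obtain a' b' c' d' where y: "y = (a', b', c', d')" by (cases y) auto
  note cong_intros = cong_mod_self cong_add cong_diff cong_mult cong_minus_minus_iff[THEN iffD2] cong_refl
  show ?thesis
  proof (cases i; cases j)
    assume [simp]: i j
    show ?thesis unfolding x y dot_def
      by (simp only: \<open>i\<close> \<open>j\<close> quat_mult.simps split_entry.simps simp_thms,
        rule cong_if_eq_minus_split_multiple[where k = "c * c' + d * d'"],
        (rule cong_intros)+, simp add: algebra_simps power2_eq_square)
  next
    assume [simp]: i "\<not> j"
    show ?thesis unfolding x y dot_def
      by (simp only: \<open>i\<close> \<open>\<not> j\<close> quat_mult.simps split_entry.simps simp_thms,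
        rule cong_if_eq_minus_split_multiple[where k = "d * c' - c * d'"],
        (rule cong_intros)+, simp add: algebra_simps power2_eq_square)
  next
    assume [simp]: "\<not> i" j
    show ?thesis unfolding x y dot_def
      by (simp only: \<open>\<not> i\<close> \<open>j\<close> quat_mult.simps split_entry.simps simp_thms,
        rule cong_if_eq_minus_split_multiple[where k = "c * d' - d * c'"],
        (rule cong_intros)+, simp add: algebra_simps power2_eq_square)
  next
    assume [simp]: "\<not> i" "\<not> j"
    show ?thesis unfolding x y dot_def
      by (simp only: \<open>\<not> i\<close> \<open>\<not> j\<close> quat_mult.simps split_entry.simps simp_thms,
        rule cong_if_eq_minus_split_multiple[where k = "c * c' + d * d'"],
        (rule cong_intros)+, simp add: algebra_simps power2_eq_square)
  qed
qed

lemma dvd_two_mult_iff: "int p dvd 2 * z \<longleftrightarrow> int p dvd z"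
proof -
  have "\<not> int p dvd 2"
    using p by (metis even_Suc_Suc_iff int_dvd_int_iff of_nat_numeral primes_dvd_imp_eq two_is_prime_nat
        even_of_nat dvd_refl)
  then show ?thesis using prime_dvd_mult_iff[OF prime_int_p] by auto
qed

text \<open>
  Sums and differences of the entries give \<open>2 a\<close>, \<open>2 b\<close> and then \<open>\<alpha> c - \<beta> d\<close> and \<open>\<beta> c + \<alpha> d\<close>. The last
  two are linear forms in \<open>c\<close>, \<open>d\<close> with determinant \<open>\<alpha>^2 + \<beta>^2\<close>, which is \<open>-1\<close> modulo \<open>p\<close>.
\<close>

lemma dvd_if_entries_dvd:
  assumes "\<And>i j. int p dvd entry (a, b, c, d) i j"
  shows "int p dvd a" "int p dvd b" "int p dvd c" "int p dvd d"
proof -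
  have e: "int p dvd a + \<alpha> * c - \<beta> * d" "int p dvd - b + \<beta> * c + \<alpha> * d"
    "int p dvd b + \<beta> * c + \<alpha> * d" "int p dvd a - \<alpha> * c + \<beta> * d"
    using assms[of False False] assms[of False True] assms[of True False] assms[of True True]
    by simp_all
  have "int p dvd 2 * a" using dvd_add[OF e(1,4)] by simp
  then show a: "int p dvd a" by (simp add: dvd_two_mult_iff)
  have "int p dvd 2 * b" using dvd_diff[OF e(3,2)] by simp
  then show b: "int p dvd b" by (simp add: dvd_two_mult_iff)
  have S: "int p dvd \<alpha> * c - \<beta> * d" using dvd_diff[OF e(1) a] by simp
  have T: "int p dvd \<beta> * c + \<alpha> * d" using dvd_diff[OF e(3) b] by simp
  have "int p dvd (\<alpha>\<^sup>2 + \<beta>\<^sup>2 + 1) * c - (\<alpha> * (\<alpha> * c - \<beta> * d) + \<beta> * (\<beta> * c + \<alpha> * d))"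
    using S T split by (intro dvd_diff dvd_add) auto
  then show "int p dvd c" by (simp add: algebra_simps power2_eq_square)
  have "int p dvd (\<alpha>\<^sup>2 + \<beta>\<^sup>2 + 1) * d - (\<alpha> * (\<beta> * c + \<alpha> * d) - \<beta> * (\<alpha> * c - \<beta> * d))"
    using S T split by (intro dvd_diff) auto
  then show "int p dvd d" by (simp add: algebra_simps power2_eq_square)
qed

lemma eq_if_entries_cong:
  assumes "x \<in> lipschitz_carrier p" "y \<in> lipschitz_carrier p"
    and cong: "\<And>i j. [entry x i j = entry y i j] (mod int p)"
  shows "x = y"
proof -
  obtain a b c d where x: "x = (a, b, c, d)" by (cases x) auto
  obtain a' b' c' d' where y: "y = (a', b', c', d')" by (cases y) auto
  have "entry (a - a', b - b', c - c', d - d') i j = entry x i j - entry y i j" for i j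
    by (cases i; cases j) (simp_all add: x y algebra_simps)
  then have dvd: "int p dvd a - a'" "int p dvd b - b'" "int p dvd c - c'" "int p dvd d - d'"
    using cong dvd_if_entries_dvd[of "a - a'" "b - b'" "c - c'" "d - d'"]
    by (simp_all add: cong_iff_dvd_diff)
  have "z = z'" if "z \<in> {0..<int p}" "z' \<in> {0..<int p}" "int p dvd z - z'" for z z'
    using that by (metis atLeastLessThan_iff cong_iff_dvd_diff cong_less_imp_eq_int)
  then show ?thesis using assms(1,2) dvd unfolding x y mem_lipschitz_carrier by blast
qed

lemma zero_mem_carrier: "(0, 0, 0, 0) \<in> lipschitz_carrier p"
  using p(1) prime_gt_0_nat by (auto simp: mem_lipschitz_carrier)

lemma entry_zero: "entry (0, 0, 0, 0) i j = 0"
  by (cases i; cases j) simp_all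

lemma quat_mult_mem_carrier: "quat_mult p x y \<in> lipschitz_carrier p"
  using p(1) prime_gt_0_nat by (cases x; cases y) (auto simp: mem_lipschitz_carrier)

lemma eq_zero_iff_entries_dvd:
  assumes "x \<in> lipschitz_carrier p"
  shows "x = (0, 0, 0, 0) \<longleftrightarrow> (\<forall>i j. int p dvd entry x i j)"
  using eq_if_entries_cong[OF assms zero_mem_carrier] by (auto simp: entry_zero cong_0_iff)

lemma quat_mult_eq_zero_iff:
  "quat_mult p x y = (0, 0, 0, 0) \<longleftrightarrow> (\<forall>i j. int p dvd dot (entry x i) (\<lambda>l. entry y l j))"
  using cong_dvd_iff[OF entry_mult]
  by (simp add: eq_zero_iff_entries_dvd[OF quat_mult_mem_carrier])

text \<open>
  The linear system for the coordinates is solved explicitly, where \<open>h\<close> is the inverse of 2 modulo \<open>p\<close>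
  and the matrix \<open>(\<alpha>, -\<beta>; \<beta>, \<alpha>)\<close> has the inverse \<open>- (\<alpha>, \<beta>; -\<beta>, \<alpha>)\<close>.
\<close>

lemma exists_entries:
  "\<exists>x \<in> lipschitz_carrier p. \<forall>i j. [entry x i j = M i j] (mod int p)"
proof -
  obtain h where h: "p = 2 * h - 1"
    using p(2) by (metis add_diff_cancel_right' oddE Suc_eq_plus1 mult_Suc_right diff_Suc_1 add_2_eq_Suc)
  have h': "2 * int h = int p + 1" using h p(1) prime_gt_0_nat[of p] by linarith
  let ?S = "int h * (M False False - M True True)" and ?T = "int h * (M False True + M True False)"
  define a where "a = int h * (M False False + M True True)"
  define b where "b = int h * (M True False - M False True)"
  define c where "c = - (\<alpha> * ?S + \<beta> * ?T)"
  define d where "d = - (\<alpha> * ?T - \<beta> * ?S)"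
  let ?x = "(a mod int p, b mod int p, c mod int p, d mod int p)"
  have S: "[\<alpha> * c - \<beta> * d = ?S] (mod int p)"
    by (rule cong_if_eq_minus_split_multiple[OF cong_refl, where k = ?S])
      (simp add: c_def d_def power2_eq_square, simp add: algebra_simps)
  have T: "[\<beta> * c + \<alpha> * d = ?T] (mod int p)"
    by (rule cong_if_eq_minus_split_multiple[OF cong_refl, where k = ?T])
      (simp add: c_def d_def power2_eq_square, simp add: algebra_simps)
  have half: "[2 * int h * z = z] (mod int p)" for z
    unfolding h' cong_iff_dvd_diff by (simp add: algebra_simps)
  have mod: "[entry ?x i j = entry (a, b, c, d) i j] (mod int p)" for i j
    by (cases i; cases j; simp only: split_entry.simps simp_thms)
      (intro cong_add cong_diff cong_mult cong_refl cong_mod_self cong_minus_minus_iff[THEN iffD2])+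
  have "[entry (a, b, c, d) i j = M i j] (mod int p)" for i j
  proof (cases i; cases j)
    assume "i" "j"
    have "[a - (\<alpha> * c - \<beta> * d) = a - ?S] (mod int p)" by (intro cong_diff cong_refl S)
    also have "a - ?S = 2 * int h * M True True" by (simp add: a_def algebra_simps)
    also have "[2 * int h * M True True = M True True] (mod int p)" by (rule half)
    finally show ?thesis using \<open>i\<close> \<open>j\<close> by (simp add: algebra_simps)
  next
    assume "i" "\<not> j"
    have "[b + (\<beta> * c + \<alpha> * d) = b + ?T] (mod int p)" by (intro cong_add cong_refl T)
    also have "b + ?T = 2 * int h * M True False" by (simp add: b_def algebra_simps)
    also have "[2 * int h * M True False = M True False] (mod int p)" by (rule half)
    finally show ?thesis using \<open>i\<close> \<open>\<not> j\<close> by (simp add: algebra_simps)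
  next
    assume "\<not> i" "j"
    have "[(\<beta> * c + \<alpha> * d) - b = ?T - b] (mod int p)" by (intro cong_diff cong_refl T)
    also have "?T - b = 2 * int h * M False True" by (simp add: b_def algebra_simps)
    also have "[2 * int h * M False True = M False True] (mod int p)" by (rule half)
    finally show ?thesis using \<open>\<not> i\<close> \<open>j\<close> by (simp add: algebra_simps)
  next
    assume "\<not> i" "\<not> j"
    have "[a + (\<alpha> * c - \<beta> * d) = a + ?S] (mod int p)" by (intro cong_add cong_refl S)
    also have "a + ?S = 2 * int h * M False False" by (simp add: a_def algebra_simps)
    also have "[2 * int h * M False False = M False False] (mod int p)" by (rule half)
    finally show ?thesis using \<open>\<not> i\<close> \<open>\<not> j\<close> by (simp add: algebra_simps)
  qed
  then have "\<forall>i j. [entry ?x i j = M i j] (mod int p)" using mod cong_trans by blast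
  moreover have "?x \<in> lipschitz_carrier p"
    using p(1) prime_gt_0_nat by (auto simp: mem_lipschitz_carrier)
  ultimately show ?thesis by blast
qed

section \<open>Zero divisors as pairs of projective points\<close>

lemma dvd_dot_perp_point_iff:
  assumes "u \<le> p" "k \<le> p"
  shows "int p dvd dot (perp (point p k)) (point p u) \<longleftrightarrow> k = u"
proof -
  have "int p dvd int u - int k \<longleftrightarrow> k = u" if "u < p" "k < p"
    using that by (metis cong_iff_dvd_diff cong_int_iff cong_less_modulus_unique_nat cong_refl)
  moreover have "\<not> int p dvd 1" using p(1) prime_gt_1_nat[of p] by simp
  ultimately show ?thesis using assms by (auto simp: dot_def perp_def point_def)
qed

lemma exists_point_coord_not_dvd: "\<exists>i. \<not> int p dvd point p u i"
proof -
  have "\<not> int p dvd 1" using p(1) prime_gt_1_nat[of p] by simp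
  then show ?thesis by (metis point_def)
qed

lemma exists_perp_point_coord_not_dvd: "\<exists>i. \<not> int p dvd perp (point p u) i"
  using exists_point_coord_not_dvd[of u] unfolding perp_def
  by (metis (full_types) dvd_minus_iff)

lemma multiple_of_point_if_dvd_dot_perp:
  assumes "u \<le> p" "int p dvd dot (perp (point p u)) a"
  shows "\<exists>r. \<forall>i. [a i = r * point p u i] (mod int p)"
proof (cases "u = p")
  case True
  then have "int p dvd a False" using assms(2) by (simp add: dot_def perp_def point_def)
  then have "\<forall>i. [a i = a True * point p u i] (mod int p)"
    using True by (auto simp: point_def cong_0_iff)
  then show ?thesis by blast
next
  case False
  then have "int p dvd a True - a False * int u"
    using assms(2) by (simp add: dot_def perp_def point_def algebra_simps)
  then have "\<forall>i. [a i = a False * point p u i] (mod int p)"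
    using False by (auto simp: point_def cong_iff_dvd_diff)
  then show ?thesis by blast
qed

lemma nonzero_multiple_of_point:
  assumes "\<not> int p dvd a i"
  shows "\<exists>r u. u \<le> p \<and> \<not> int p dvd r \<and> (\<forall>i. [a i = r * point p u i] (mod int p))"
proof (cases "int p dvd a False")
  case True
  then have "\<not> int p dvd a True" using assms by (cases i) auto
  moreover have "\<forall>i. [a i = a True * point p p i] (mod int p)"
    using True by (auto simp: point_def cong_0_iff)
  ultimately show ?thesis by blast
next
  case False
  then have "coprime (a False) (int p)"
    using coprime_commute prime_imp_coprime[OF prime_int_p False] by blast
  then obtain c where c: "[a False * c = 1] (mod int p)" using cong_solve_coprime_int by blast
  define u where "u = nat (c * a True mod int p)"
  have "0 < int p" using p(1) prime_gt_0_nat by simp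
  then have u: "int u = c * a True mod int p" and "int u < int p" by (simp_all add: u_def)
  have "[a False * int u = a False * (c * a True)] (mod int p)"
    unfolding u by (intro cong_mult cong_refl cong_mod_self)
  also have "[a False * (c * a True) = a True] (mod int p)"
    using cong_mult[OF c cong_refl[of "a True"]] by (simp add: mult.assoc)
  finally have "[a True = a False * int u] (mod int p)" by (rule cong_sym)
  then have "\<forall>i. [a i = a False * point p u i] (mod int p)"
    using \<open>int u < int p\<close> by (auto simp: point_def)
  then show ?thesis using False \<open>int u < int p\<close> by (intro exI[of _ "a False"] exI[of _ u]) auto
qed

text \<open>
  Modulo \<open>p\<close>, the matrix of \<open>x\<close> is the column \<open>s * point p u\<close> times the row \<open>perp (point p k)\<close>; it has
  rank one, its image is spanned by the point \<open>u\<close> and its kernel by the point \<open>k\<close>.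
\<close>

definition rank_one :: "quat \<Rightarrow> int \<Rightarrow> nat \<Rightarrow> nat \<Rightarrow> bool" where
  "rank_one x s u k \<longleftrightarrow> s \<in> {1..<int p} \<and> u \<le> p \<and> k \<le> p \<and>
     (\<forall>i j. [entry x i j = s * point p u i * perp (point p k) j] (mod int p))"

text \<open>
  Some column is nonzero, hence a multiple of a point \<open>u\<close>. As the determinant vanishes, so is the other
  column. The row formed by the two factors is nonzero and thus a multiple of \<open>perp\<close> of a point \<open>k\<close>.
\<close>

lemma rank_one_if_det_dvd:
  assumes x: "x \<in> lipschitz_carrier p" "x \<noteq> (0, 0, 0, 0)"
    and det: "int p dvd entry x False False * entry x True True - entry x False True * entry x True False"
  shows "\<exists>s u k. rank_one x s u k"
proof -
  obtain i j where ij: "\<not> int p dvd entry x i j"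
    using x by (auto simp: eq_zero_iff_entries_dvd)
  from nonzero_multiple_of_point[of "\<lambda>i. entry x i j", OF ij]
  obtain r u where u: "u \<le> p" and r: "\<not> int p dvd r"
    and col: "\<And>i. [entry x i j = r * point p u i] (mod int p)" by blast
  have "\<exists>c. \<forall>i. [entry x i l = c * point p u i] (mod int p)" for l
  proof (rule multiple_of_point_if_dvd_dot_perp[OF u])
    let ?e = "\<lambda>i. entry x i l"
    have "[dot (perp (\<lambda>i. entry x i j)) ?e = r * dot (perp (point p u)) ?e] (mod int p)"
    proof -
      have "[- entry x True j * entry x False l + entry x False j * entry x True l =
          - (r * point p u True) * entry x False l + r * point p u False * entry x True l] (mod int p)"
        by (intro cong_add cong_mult cong_refl col cong_minus_minus_iff[THEN iffD2])
      then show ?thesis by (simp add: dot_def perp_def algebra_simps)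
    qed
    moreover have "int p dvd dot (perp (\<lambda>i. entry x i j)) ?e"
      using det dvd_minus_iff[of "int p"]
      by (cases j; cases l) (simp_all add: dot_def perp_def algebra_simps dvd_diff_commute)
    ultimately have "int p dvd r * dot (perp (point p u)) ?e" using cong_dvd_iff by blast
    then show "int p dvd dot (perp (point p u)) ?e"
      using r prime_dvd_mult_iff[OF prime_int_p] by blast
  qed
  then obtain c where c: "\<And>i l. [entry x i l = c l * point p u i] (mod int p)" by metis
  have "\<not> int p dvd c j" using c[of i j] ij cong_dvd_iff dvd_mult2 by blast
  then have "\<not> int p dvd (if \<not> j then - c False else c True)" by (cases j) auto
  from nonzero_multiple_of_point[where a = "\<lambda>l. if l then - c False else c True", OF this]
  obtain s k where k: "k \<le> p" and s: "\<not> int p dvd s"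
    and row: "\<And>l. [(if l then - c False else c True) = s * point p k l] (mod int p)" by blast
  have c_eq: "[c l = s * perp (point p k) l] (mod int p)" for l
    using row[of True] row[of False] cong_minus_minus_iff[of "- c False" "s * point p k True" "int p"]
    by (cases l) (simp_all add: perp_def)
  have "0 < int p" using p(1) prime_gt_0_nat by simp
  moreover have "s mod int p \<noteq> 0" using s by (simp add: dvd_eq_mod_eq_0)
  ultimately have "s mod int p \<in> {1..<int p}"
    using pos_mod_sign[of "int p" s] pos_mod_bound[of "int p" s]
    unfolding atLeastLessThan_iff by linarith
  moreover have "[entry x i l = (s mod int p) * point p u i * perp (point p k) l] (mod int p)" for i l
  proof -
    have "[entry x i l = c l * point p u i] (mod int p)" by (rule c)
    also have "[c l * point p u i = s * perp (point p k) l * point p u i] (mod int p)"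
      by (intro cong_mult cong_refl c_eq)
    also have "[s * perp (point p k) l * point p u i =
        (s mod int p) * perp (point p k) l * point p u i] (mod int p)"
      by (intro cong_mult cong_refl cong_sym[OF cong_mod_self])
    finally show ?thesis by (simp add: mult_ac)
  qed
  ultimately show ?thesis using u k by (auto simp: rank_one_def)
qed

text \<open>
  The inner factors of the product collapse to the scalar \<open>dot (perp (point p k)) (point p u')\<close>, which
  vanishes exactly when the kernel of \<open>x\<close> is the image of \<open>y\<close>.
\<close>

lemma mult_rank_one_eq_zero_iff:
  assumes x: "rank_one x s u k" and y: "rank_one y s' u' k'"
  shows "quat_mult p x y = (0, 0, 0, 0) \<longleftrightarrow> k = u'"
proof -
  let ?D = "dot (perp (point p k)) (point p u')"
  have s: "\<not> int p dvd s" "\<not> int p dvd s'"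
    using x y zdvd_not_zless[of _ "int p"] by (auto simp: rank_one_def)
  have prod: "[dot (entry x i) (\<lambda>l. entry y l j) =
      s * s' * point p u i * perp (point p k') j * ?D] (mod int p)" for i j
  proof -
    have "[dot (entry x i) (\<lambda>l. entry y l j) =
        (s * point p u i * perp (point p k) False) * (s' * point p u' False * perp (point p k') j) +
        (s * point p u i * perp (point p k) True) * (s' * point p u' True * perp (point p k') j)] (mod int p)"
      unfolding dot_def using x y by (intro cong_add cong_mult) (auto simp: rank_one_def)
    then show ?thesis by (simp add: dot_def algebra_simps)
  qed
  have "quat_mult p x y = (0, 0, 0, 0) \<longleftrightarrow>
      (\<forall>i j. int p dvd s * s' * point p u i * perp (point p k') j * ?D)"
    unfolding quat_mult_eq_zero_iff using cong_dvd_iff[OF prod] by simp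
  also have "\<dots> \<longleftrightarrow> int p dvd ?D"
    using s exists_point_coord_not_dvd[of u] exists_perp_point_coord_not_dvd[of k']
    by (auto simp: prime_dvd_mult_iff[OF prime_int_p])
  also have "\<dots> \<longleftrightarrow> k = u'"
    using x y by (intro dvd_dot_perp_point_iff) (auto simp: rank_one_def)
  finally show ?thesis .
qed

lemma exists_rank_one:
  assumes "s \<in> {1..<int p}" "u \<le> p" "k \<le> p"
  shows "\<exists>x \<in> lipschitz_carrier p. rank_one x s u k"
  using exists_entries[of "\<lambda>i j. s * point p u i * perp (point p k) j"] assms
  by (auto simp: rank_one_def)

lemma one_mem_scalars: "1 \<in> {1..<int p}"
  using p(1) prime_gt_1_nat[of p] by simp

lemma rank_one_neq_zero:
  assumes "rank_one x s u k"
  shows "x \<noteq> (0, 0, 0, 0)"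
proof
  assume zero: "x = (0, 0, 0, 0)"
  \<comment> \<open>A product of 0 with anything is 0, also with a quaternion whose image differs from \<open>k\<close>.\<close>
  define u' :: nat where "u' = (if k = 0 then 1 else 0)"
  have "u' \<le> p" "u' \<noteq> k" using p(1) prime_gt_0_nat[of p] by (auto simp: u'_def)
  then obtain y where y: "rank_one y 1 u' 0"
    using exists_rank_one[OF one_mem_scalars, of u' 0] by auto
  have "quat_mult p x y = (0, 0, 0, 0)" by (cases y) (simp add: zero)
  then show False using mult_rank_one_eq_zero_iff[OF assms y] \<open>u' \<noteq> k\<close> by simp
qed

text \<open>
  By \<open>mult_rank_one_eq_zero_iff\<close> the two products of \<open>x\<close> with a quaternion of image \<open>k\<close> and kernel \<open>u\<close>
  are 0, and they would not both be 0 for an \<open>x\<close> with another image or kernel. The scalar is then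
  determined by any nonzero entry.
\<close>

lemma rank_one_unique:
  assumes x: "rank_one x s u k" "rank_one x s' u' k'"
  shows "s = s' \<and> u = u' \<and> k = k'"
proof -
  have uk: "u \<le> p" "k \<le> p" using x by (auto simp: rank_one_def)
  obtain y where y: "rank_one y 1 k u" using exists_rank_one[OF one_mem_scalars uk(2,1)] by blast
  have k: "k = k'" and u: "u = u'"
    using mult_rank_one_eq_zero_iff[OF x(1) y] mult_rank_one_eq_zero_iff[OF x(2) y]
      mult_rank_one_eq_zero_iff[OF y x(1)] mult_rank_one_eq_zero_iff[OF y x(2)] by auto
  obtain i j where ij: "\<not> int p dvd point p u i" "\<not> int p dvd perp (point p k) j"
    using exists_point_coord_not_dvd exists_perp_point_coord_not_dvd by blast
  have "[s * (point p u i * perp (point p k) j) = s' * (point p u i * perp (point p k) j)] (mod int p)"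
    using x unfolding rank_one_def k u mult.assoc by (meson cong_sym cong_trans)
  then have "int p dvd (s - s') * (point p u i * perp (point p k) j)"
    by (simp add: cong_iff_dvd_diff left_diff_distrib)
  then have "int p dvd s - s'" using ij by (simp add: prime_dvd_mult_iff[OF prime_int_p])
  then have "s = s'"
    using x by (auto simp: rank_one_def cong_iff_dvd_diff[symmetric] intro: cong_less_imp_eq_int)
  with k u show ?thesis by simp
qed

text \<open>
  If \<open>x\<close> annihilates a nonzero \<open>y\<close> from either side, multiplication with the adjugate of the matrix of
  \<open>x\<close> shows that the determinant of \<open>x\<close> times any entry of \<open>y\<close> is 0. Conversely, a rank-one \<open>x\<close> with
  kernel \<open>k\<close> annihilates every \<open>y\<close> with image \<open>k\<close>.
\<close>

lemma zero_divisor_iff_rank_one: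
  "x \<in> zero_divisors (lipschitz_ring p) \<longleftrightarrow>
     x \<in> lipschitz_carrier p \<and> (\<exists>s u k. rank_one x s u k)"
proof
  assume "x \<in> zero_divisors (lipschitz_ring p)"
  then obtain y where x: "x \<in> lipschitz_carrier p" "x \<noteq> (0, 0, 0, 0)"
    and y: "y \<in> lipschitz_carrier p" "y \<noteq> (0, 0, 0, 0)"
    and xy: "quat_mult p x y = (0, 0, 0, 0) \<or> quat_mult p y x = (0, 0, 0, 0)"
    by (auto simp: zero_divisors_def lipschitz_ring_def)
  let ?det = "entry x False False * entry x True True - entry x False True * entry x True False"
  obtain i j where ij: "\<not> int p dvd entry y i j"
    using y by (auto simp: eq_zero_iff_entries_dvd)
  have "int p dvd ?det * entry y i j"
    using xy
  proof
    assume "quat_mult p x y = (0, 0, 0, 0)"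
    then have F: "int p dvd dot (entry x False) (\<lambda>l. entry y l j)"
      and T: "int p dvd dot (entry x True) (\<lambda>l. entry y l j)"
      by (simp_all add: quat_mult_eq_zero_iff)
    show ?thesis
    proof (cases i)
      case True
      have "?det * entry y i j = entry x False False * dot (entry x True) (\<lambda>l. entry y l j) -
          entry x True False * dot (entry x False) (\<lambda>l. entry y l j)"
        using True by (simp add: dot_def algebra_simps)
      then show ?thesis using F T by simp
    next
      case False
      have "?det * entry y i j = entry x True True * dot (entry x False) (\<lambda>l. entry y l j) -
          entry x False True * dot (entry x True) (\<lambda>l. entry y l j)"
        using False by (simp add: dot_def algebra_simps)
      then show ?thesis using F T by simp
    qed
  next
    assume "quat_mult p y x = (0, 0, 0, 0)"
    then have F: "int p dvd dot (entry y i) (\<lambda>l. entry x l False)"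
      and T: "int p dvd dot (entry y i) (\<lambda>l. entry x l True)"
      by (simp_all add: quat_mult_eq_zero_iff)
    show ?thesis
    proof (cases j)
      case True
      have "?det * entry y i j = entry x False False * dot (entry y i) (\<lambda>l. entry x l True) -
          entry x False True * dot (entry y i) (\<lambda>l. entry x l False)"
        using True by (simp add: dot_def algebra_simps)
      then show ?thesis using F T by simp
    next
      case False
      have "?det * entry y i j = entry x True True * dot (entry y i) (\<lambda>l. entry x l False) -
          entry x True False * dot (entry y i) (\<lambda>l. entry x l True)"
        using False by (simp add: dot_def algebra_simps)
      then show ?thesis using F T by simp
    qed
  qed
  then have "int p dvd ?det" using ij prime_dvd_mult_iff[OF prime_int_p] by blast
  then show "x \<in> lipschitz_carrier p \<and> (\<exists>s u k. rank_one x s u k)"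
    using rank_one_if_det_dvd[OF x] x by blast
next
  assume "x \<in> lipschitz_carrier p \<and> (\<exists>s u k. rank_one x s u k)"
  then obtain s u k where x: "x \<in> lipschitz_carrier p" "rank_one x s u k" by blast
  then have "k \<le> p" by (simp add: rank_one_def)
  then obtain y where y: "y \<in> lipschitz_carrier p" "rank_one y 1 k k"
    using exists_rank_one[OF one_mem_scalars] by blast
  then have "quat_mult p x y = (0, 0, 0, 0)" using mult_rank_one_eq_zero_iff[OF x(2)] by blast
  then show "x \<in> zero_divisors (lipschitz_ring p)"
    unfolding zero_divisors_def mem_Collect_eq
    using x(1) y(1) rank_one_neq_zero[OF x(2)] rank_one_neq_zero[OF y(2)]
    by (intro conjI bexI[of _ y] disjI1) (simp_all add: lipschitz_ring_def)
qed

text \<open>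
  The head of a zero divisor is its image and the tail is its kernel. A class is parametrised by the
  scalars \<open>1, ..., p - 1\<close>.
\<close>

lemma obtain_head_tail:
  defines "V \<equiv> zero_divisors (lipschitz_ring p)"
  obtains H T :: "quat \<Rightarrow> nat"
  where "\<And>x. x \<in> V \<Longrightarrow> H x \<in> {..p} \<and> T x \<in> {..p}"
    and "\<And>x y. x \<in> V \<Longrightarrow> y \<in> V \<Longrightarrow> quat_mult p x y = (0, 0, 0, 0) \<longleftrightarrow> T x = H y"
    and "\<And>a b. a \<in> {..p} \<Longrightarrow> b \<in> {..p} \<Longrightarrow> card {x \<in> V. H x = a \<and> T x = b} = p - 1"
proof -
  have "\<forall>x\<in>V. \<exists>s u k. rank_one x s u k"
    by (simp add: V_def zero_divisor_iff_rank_one)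
  then obtain S H T where V: "\<And>x. x \<in> V \<Longrightarrow> rank_one x (S x) (H x) (T x)" by metis
  have "card {x \<in> V. H x = a \<and> T x = b} = p - 1" if "a \<le> p" "b \<le> p" for a b
  proof -
    let ?K = "{x \<in> V. H x = a \<and> T x = b}"
    have inj: "inj_on S ?K"
    proof (rule inj_onI)
      fix x y assume x: "x \<in> ?K" and y: "y \<in> ?K" and S: "S x = S y"
      have Vx: "x \<in> V" and Vy: "y \<in> V" using x y by blast+
      have same: "H x = H y" "T x = T y" using x y by simp_all
      show "x = y"
      proof (rule eq_if_entries_cong)
        show "x \<in> lipschitz_carrier p" "y \<in> lipschitz_carrier p"
          using Vx Vy unfolding V_def zero_divisor_iff_rank_one by blast+
        fix i j
        have "[entry x i j = S y * point p (H y) i * perp (point p (T y)) j] (mod int p)"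
          using V[OF Vx] unfolding rank_one_def S same by blast
        moreover have "[entry y i j = S y * point p (H y) i * perp (point p (T y)) j] (mod int p)"
          using V[OF Vy] unfolding rank_one_def by blast
        ultimately show "[entry x i j = entry y i j] (mod int p)"
          by (rule cong_trans[OF _ cong_sym])
      qed
    qed
    have into: "S x \<in> {1..<int p}" if "x \<in> V" for x
      using V[OF that] unfolding rank_one_def by blast
    have onto: "\<exists>x \<in> ?K. S x = s" if s: "s \<in> {1..<int p}" for s
    proof -
      from exists_rank_one[OF s \<open>a \<le> p\<close> \<open>b \<le> p\<close>]
      obtain x where x: "x \<in> lipschitz_carrier p" "rank_one x s a b" by blast
      then have Vx: "x \<in> V" unfolding V_def zero_divisor_iff_rank_one by blast
      show ?thesis using rank_one_unique[OF x(2) V[OF Vx]] Vx by (intro bexI[of _ x]) simp_all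
    qed
    have "S ` ?K = {1..<int p}"
    proof (rule equalityI)
      show "S ` ?K \<subseteq> {1..<int p}" by (rule image_subsetI) (rule into, simp)
      show "{1..<int p} \<subseteq> S ` ?K"
      proof (rule subsetI)
        fix s assume "s \<in> {1..<int p}"
        from onto[OF this] obtain x where "x \<in> ?K" "s = S x" by (elim bexE) simp
        then show "s \<in> S ` ?K" by (intro image_eqI)
      qed
    qed
    with inj have "bij_betw S ?K {1..<int p}" by (rule bij_betw_imageI)
    then have "card {x \<in> V. H x = a \<and> T x = b} = card {1..<int p}" by (rule bij_betw_same_card)
    then show ?thesis by simp
  qed
  moreover have "H x \<in> {..p} \<and> T x \<in> {..p}" if "x \<in> V" for x
    using V[OF that] by (simp add: rank_one_def)
  moreover have "quat_mult p x y = (0, 0, 0, 0) \<longleftrightarrow> T x = H y" if "x \<in> V" "y \<in> V" for x y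
    using V[OF that(1)] V[OF that(2)] by (rule mult_rank_one_eq_zero_iff)
  ultimately show thesis by (intro that[of H T]) (simp_all only: atMost_iff)
qed

end

section \<open>The zero-divisor graph of the Lipschitz quaternions\<close>

theorem corollary4p4:
  fixes p :: nat and vs :: "quat list" and A :: "real mat"
  assumes "prime p" and "odd p"
    and "enumerates_verts vs (zero_divisor_graph (lipschitz_ring p))"
  defines "A \<equiv> adjacency_matrix (zero_divisor_graph (lipschitz_ring p)) vs"
  shows "kernel_dim A = p * (p + 1) * (p - 2)
    \<and> eigenvalue_mult A (- 1) = (p + 1) * (p - 2)
    \<and> mat_rank A = (p + 1) * (2 * p - 1)"
proof -
  let ?V = "zero_divisors (lipschitz_ring p)" and ?n = "length vs"
  have vs: "distinct vs" "set vs = ?V"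
    using assms(3) by (auto simp: enumerates_verts_def zero_divisor_graph_def)
  have p3: "3 \<le> p"
    using assms(1,2) prime_ge_2_nat[of p] by (cases "p = 2") auto
  obtain \<alpha> \<beta> :: int where "int p dvd \<alpha>\<^sup>2 + \<beta>\<^sup>2 + 1"
    using exists_sum_of_two_squares_eq_minus_one[OF assms(1,2)] by blast
  then interpret split_quaternions p \<alpha> \<beta>
    using assms(1,2) by unfold_locales
  obtain H T :: "quat \<Rightarrow> nat" where HT: "\<And>x. x \<in> ?V \<Longrightarrow> H x \<in> {..p} \<and> T x \<in> {..p}"
    and mult: "\<And>x y. x \<in> ?V \<Longrightarrow> y \<in> ?V \<Longrightarrow> quat_mult p x y = (0, 0, 0, 0) \<longleftrightarrow> T x = H y"
    and card: "\<And>a b. a \<in> {..p} \<Longrightarrow> b \<in> {..p} \<Longrightarrow> card {x \<in> ?V. H x = a \<and> T x = b} = p - 1"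
    by (rule obtain_head_tail[OF that])
  define h t where "h i = H (vs ! i)" and "t i = T (vs ! i)" for i
  have mem: "vs ! i \<in> ?V" if "i < ?n" for i using that vs(2) nth_mem by blast
  interpret equal_head_tail_classes ?n "{..p}" h t "p + 1" "p - 1"
  proof
    fix a b assume ab: "a \<in> {..p}" "b \<in> {..p}"
    have "(!) vs ` {i. i < ?n \<and> h i = a \<and> t i = b} = {x \<in> ?V. H x = a \<and> T x = b}"
    proof (rule equalityI)
      show "(!) vs ` {i. i < ?n \<and> h i = a \<and> t i = b} \<subseteq> {x \<in> ?V. H x = a \<and> T x = b}"
        by (rule image_subsetI) (simp add: h_def t_def mem)
      show "{x \<in> ?V. H x = a \<and> T x = b} \<subseteq> (!) vs ` {i. i < ?n \<and> h i = a \<and> t i = b}"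
      proof (rule subsetI)
        fix x assume x: "x \<in> {x \<in> ?V. H x = a \<and> T x = b}"
        then have "x \<in> set vs" by (simp add: vs(2))
        then obtain i where "i < ?n" "vs ! i = x" by (auto simp only: in_set_conv_nth)
        then show "x \<in> (!) vs ` {i. i < ?n \<and> h i = a \<and> t i = b}"
          using x by (intro image_eqI[of _ _ i]) (simp_all add: h_def t_def)
      qed
    qed
    moreover have "inj_on ((!) vs) {i. i < ?n \<and> h i = a \<and> t i = b}"
      by (rule inj_on_nth[OF vs(1)]) auto
    ultimately show "card {i. i < ?n \<and> h i = a \<and> t i = b} = p - 1"
      using card[OF ab] by (simp add: card_image[symmetric])
  qed (use p3 mem HT in \<open>auto simp: h_def t_def\<close>)
  have "A = head_tail_matrix ?n h t"
  proof (rule eq_matI)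
    fix i j assume "i < dim_row (head_tail_matrix ?n h t)" "j < dim_col (head_tail_matrix ?n h t)"
    then have ij: "i < ?n" "j < ?n" by (simp_all add: head_tail_matrix_def)
    have "(vs ! i, vs ! j) \<in> parcs (zero_divisor_graph (lipschitz_ring p)) \<longleftrightarrow>
        vs ! i \<noteq> vs ! j \<and> (quat_mult p (vs ! i) (vs ! j) = (0, 0, 0, 0) \<or>
          quat_mult p (vs ! j) (vs ! i) = (0, 0, 0, 0))"
      using mem ij by (simp add: zero_divisor_graph_def lipschitz_ring_def)
    also have "\<dots> \<longleftrightarrow> i \<noteq> j \<and> (t i = h j \<or> t j = h i)"
      using mult[OF mem mem] ij vs(1) by (simp add: nth_eq_iff_index_eq h_def t_def)
    finally show "A $$ (i, j) = head_tail_matrix ?n h t $$ (i, j)"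
      using ij by (simp add: A_def adjacency_matrix_def head_tail_matrix_def)
  qed (simp_all add: A_def adjacency_matrix_def head_tail_matrix_def)
  moreover have "p + 1 + (p - 1) - 1 = 2 * p - 1" "p - 1 - 1 = p - 2" using p3 by simp_all
  ultimately show ?thesis
    using nullity_multiplicity_rank_head_tail_matrix by (simp add: mult.commute mult.left_commute)
qed

end
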